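(* Let $\alpha\in[0,\pi/2)$ and let $\{F(\tau)\}_{\tau\ge0}$ be a family of uniformly quasi-sectorial contractions on a Hilbert space $\mathfrak{H}$, i.e. contractions with $W(F(\tau))\subseteq D_\alpha$ for all $\tau>0$. Let $H$ be an $m$-sectorial operator in $\mathfrak{H}$ with $W(H)\subseteq S_\alpha$, and let $\{S(\tau)\}_{\tau>0}$ be the family of $m$-sectorial operators $S(\tau):=(\mathds{1}-F(\tau))/\tau$, with $\operatorname{s-lim}_{\tau\to+0}(\mathds{1}+S(\tau))^{-1}=(\mathds{1}+H)^{-1}$. If there is $L>0$ such that $$\left\|(\zeta\mathds{1}+S(\tau))^{-1}-(\zeta\mathds{1}+H)^{-1}\right\|\le\frac{L\,\tau}{\operatorname{dist}(\zeta,-S_\alpha)}$$ holds for all $\zeta\in S_{\pi-\alpha}$ (and all $\tau>0$), then for any bounded interval $\mathcal{I}\subset(0,\infty)$ there is a constant $C^{\mathcal{I}}>0$ such that $$\sup_{t\in\mathcal{I}}\|F(t/n)^n-e^{-tH}\|\le C^{\mathcal{I}}\,\frac{1}{n^{1/3}}$$ holds for all integers $n\ge1$.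
   Context: $\|\cdot\|$ is the operator norm, $\mathds{1}$ the identity operator, $\operatorname{s-lim}$ the limit in the strong operator topology, and $W(A)$ the numerical range of an operator $A$. For an angle $\gamma$, $S_\gamma\subset\mathbb{C}$ denotes the open sector with semi-angle $\gamma$ (symmetric about the positive real axis) and vertex at $z=0$, and $-S_\gamma=\{-z:z\in S_\gamma\}$. For $\alpha\in[0,\pi/2)$, $D_\alpha$ is the closed domain $$D_\alpha:=\{z\in\mathbb{C}:|z|\le\sin\alpha\}\cup\{z\in\mathbb{C}:|\arg(1-z)|\le\alpha\ \text{and}\ |z-1|\le\cos\alpha\}.$$ A contraction $F$ on $\mathfrak{H}$ is called quasi-sectorial with semi-angle $\alpha\in[0,\pi/2)$ with respect to the vertex at $z=1$ if $W(F)\subseteq D_\alpha$. $e^{-tH}$ is the contraction $C_0$-semigroup generated by $-H$. *)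

theory Defs
  imports "HOL-Analysis.Analysis"
begin

text \<open>Complex Hilbert spaces; the inner product is antilinear in its first argument.\<close>

class complex_hilbert_space = banach +
  fixes scaleC :: "complex \<Rightarrow> 'a \<Rightarrow> 'a" (infixr \<open>*\<^sub>C\<close> 75)
    and cinner :: "'a \<Rightarrow> 'a \<Rightarrow> complex"
  assumes scaleR_scaleC: "r *\<^sub>R x = complex_of_real r *\<^sub>C x"
    and scaleC_add_right: "c *\<^sub>C (x + y) = c *\<^sub>C x + c *\<^sub>C y"
    and scaleC_add_left: "(c + d) *\<^sub>C x = c *\<^sub>C x + d *\<^sub>C x"
    and scaleC_scaleC: "c *\<^sub>C d *\<^sub>C x = (c * d) *\<^sub>C x"
    and cinner_commute: "cinner x y = cnj (cinner y x)"
    and cinner_add_right: "cinner x (y + z) = cinner x y + cinner x z"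
    and cinner_scaleC_right: "cinner x (c *\<^sub>C y) = c * cinner x y"
    and cinner_self: "cinner x x = complex_of_real ((norm x)\<^sup>2)"

instantiation complex :: complex_hilbert_space
begin

definition scaleC_complex :: "complex \<Rightarrow> complex \<Rightarrow> complex" where
  "scaleC_complex c x = c * x"

definition cinner_complex :: "complex \<Rightarrow> complex \<Rightarrow> complex" where
  "cinner_complex x y = cnj x * y"

instance
  by standard
    (auto simp: scaleC_complex_def cinner_complex_def scaleR_conv_of_real algebra_simps
      complex_norm_square simp flip: of_real_power)

end

definition bounded_clinear :: "('a::complex_hilbert_space \<Rightarrow> 'a) \<Rightarrow> bool" where
  "bounded_clinear A \<longleftrightarrow> bounded_linear A \<and> (\<forall>c x. A (c *\<^sub>C x) = c *\<^sub>C A x)"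

definition contraction :: "('a::complex_hilbert_space \<Rightarrow> 'a) \<Rightarrow> bool" where
  "contraction A \<longleftrightarrow> bounded_clinear A \<and> onorm A \<le> 1"

text \<open>An unbounded operator is given by its domain \<open>D\<close> together with a function \<open>A\<close>, of which
  only the values on \<open>D\<close> matter. Everywhere defined operators have \<open>D = UNIV\<close>.\<close>

definition linear_operator :: "'a::complex_hilbert_space set \<Rightarrow> ('a \<Rightarrow> 'a) \<Rightarrow> bool" where
  "linear_operator D A \<longleftrightarrow>
     0 \<in> D \<and>
     (\<forall>x\<in>D. \<forall>y\<in>D. x + y \<in> D \<and> A (x + y) = A x + A y) \<and>
     (\<forall>c. \<forall>x\<in>D. c *\<^sub>C x \<in> D \<and> A (c *\<^sub>C x) = c *\<^sub>C A x)"

definition numerical_range :: "'a::complex_hilbert_space set \<Rightarrow> ('a \<Rightarrow> 'a) \<Rightarrow> complex set" where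
  "numerical_range D A = {cinner x (A x) | x. x \<in> D \<and> norm x = 1}"

text \<open>The inverse of \<open>\<zeta>\<one> + A\<close>, meaningful when this operator maps \<open>D\<close> bijectively onto the space.\<close>

definition shifted_inverse ::
    "'a::complex_hilbert_space set \<Rightarrow> ('a \<Rightarrow> 'a) \<Rightarrow> complex \<Rightarrow> 'a \<Rightarrow> 'a" where
  "shifted_inverse D A \<zeta> = the_inv_into D (\<lambda>x. \<zeta> *\<^sub>C x + A x)"

text \<open>m-accretive, quasi-m-accretive and m-sectorial operators in the sense of Kato
  (Perturbation Theory for Linear Operators, Section V.3.10).\<close>

definition m_accretive :: "'a::complex_hilbert_space set \<Rightarrow> ('a \<Rightarrow> 'a) \<Rightarrow> bool" where
  "m_accretive D A \<longleftrightarrow>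
     linear_operator D A \<and> closure D = UNIV \<and>
     (\<forall>\<zeta>. Re \<zeta> > 0 \<longrightarrow>
        bij_betw (\<lambda>x. \<zeta> *\<^sub>C x + A x) D UNIV \<and>
        bounded_clinear (shifted_inverse D A \<zeta>) \<and>
        onorm (shifted_inverse D A \<zeta>) \<le> 1 / Re \<zeta>)"

definition quasi_m_accretive :: "'a::complex_hilbert_space set \<Rightarrow> ('a \<Rightarrow> 'a) \<Rightarrow> bool" where
  "quasi_m_accretive D A \<longleftrightarrow> (\<exists>c::real. m_accretive D (\<lambda>x. A x + c *\<^sub>R x))"

text \<open>Since \<open>Arg 0 = 0\<close>, the vertex belongs to the closed sectors in the next two definitions.\<close>

definition m_sectorial :: "'a::complex_hilbert_space set \<Rightarrow> ('a \<Rightarrow> 'a) \<Rightarrow> bool" where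
  "m_sectorial D A \<longleftrightarrow> quasi_m_accretive D A \<and>
     (\<exists>v::real. \<exists>\<theta>. 0 \<le> \<theta> \<and> \<theta> < pi / 2 \<and>
        numerical_range D A \<subseteq> {z. \<bar>Arg (z - complex_of_real v)\<bar> \<le> \<theta>})"

definition D_dom :: "real \<Rightarrow> complex set" where
  "D_dom \<alpha> = {z. cmod z \<le> sin \<alpha>} \<union> {z. \<bar>Arg (1 - z)\<bar> \<le> \<alpha> \<and> cmod (z - 1) \<le> cos \<alpha>}"

text \<open>The open sector with vertex \<open>0\<close>. For \<open>\<gamma> > 0\<close> the disjunct \<open>Arg z = 0\<close> is redundant; for
  \<open>\<gamma> = 0\<close> (the self-adjoint case) it makes the sector degenerate to the open positive half-line
  instead of the empty set.\<close>

definition sector :: "real \<Rightarrow> complex set" where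
  "sector \<gamma> = {z. z \<noteq> 0 \<and> (\<bar>Arg z\<bar> < \<gamma> \<or> Arg z = 0)}"

definition contraction_C0_semigroup :: "(real \<Rightarrow> 'a::complex_hilbert_space \<Rightarrow> 'a) \<Rightarrow> bool" where
  "contraction_C0_semigroup T \<longleftrightarrow>
     (\<forall>t\<ge>0. contraction (T t)) \<and> T 0 = id \<and>
     (\<forall>s\<ge>0. \<forall>t\<ge>0. T (s + t) = T s \<circ> T t) \<and>
     (\<forall>x. ((\<lambda>t. T t x) \<longlongrightarrow> x) (at_right 0))"

definition generator_of ::
    "(real \<Rightarrow> 'a::complex_hilbert_space \<Rightarrow> 'a) \<Rightarrow> 'a set \<Rightarrow> ('a \<Rightarrow> 'a) \<Rightarrow> bool" where
  "generator_of T D A \<longleftrightarrow>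
     (\<forall>x y. ((\<lambda>h. (T h x - x) /\<^sub>R h) \<longlongrightarrow> y) (at_right 0) \<longleftrightarrow> x \<in> D \<and> y = A x)"

end

theory Submission imports Defs begin

text \<open>Fix \<open>t\<close> and \<open>n\<close>, and put \<open>\<tau> = t / n\<close>. The power \<open>F(\<tau>)\<^sup>n\<close> is compared with the semigroup through
two intermediate powers, those of the implicit Euler steps \<open>B = (1 + \<tau> S(\<tau>))\<^sup>-\<^sup>1\<close> and
\<open>G = (1 + \<tau> H)\<^sup>-\<^sup>1\<close>. Contour integrals and exponentials of \<open>S(\<tau>)\<close> are avoided.

The engine is the decay \<open>\<parallel>(1 - V) V\<^sup>k\<parallel> \<le> C / (k + 1)\<close>. It holds, with an explicit constant, for every
contraction \<open>V\<close> on a complex Hilbert space such that \<open>\<parallel>(1 - V) x\<parallel> \<le> K \<parallel>(\<mu> - V) x\<parallel>\<close> whenever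
\<open>\<bar>\<mu>\<bar> = 1\<close> (\<open>Ritt_resolvent_imp_power_decay\<close>, by Parseval's identity on a finite cyclic group). For \<open>F(\<tau>)\<close>
this condition follows from the shape of the domain that contains the numerical range, and for \<open>B\<close> and
\<open>G\<close> from sectoriality; in each case \<open>K\<close> depends on \<open>\<alpha>\<close> only.

The decay is used twice in each telescoping sum \<open>U\<^sup>n - V\<^sup>n = \<Sum> U\<^sup>n\<^sup>-\<^sup>1\<^sup>-\<^sup>k (U - V) V\<^sup>k\<close>, once on either side
of \<open>U - V\<close>. This bounds the sum by \<open>\<Sum> 1 / ((n - k) (k + 1))\<close>, which is of order \<open>ln n / n\<close> and
in particular at most \<open>4 / \<surd>n\<close> (\<open>funpow_difference_le\<close>). It applies because the differences factor:

  \<^item> \<open>F - B = - (1 - F) (1 - B)\<close>, which is used in \<open>quasi_sectorial_vs_Euler\<close>.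

  \<^item> \<open>B - G = (1 / \<tau>) (B / n + 1 - B) (Q - R) (G / n + 1 - G)\<close>, where \<open>Q\<close> and \<open>R\<close> are the
    resolvents of \<open>S(\<tau>)\<close> and \<open>H\<close> at the point \<open>1 / t\<close>. The resolvent estimate gives
    \<open>\<parallel>Q - R\<parallel> \<le> L \<tau> t\<close>, so the factor in front of the sum is at most \<open>L t\<close>; this is where the
    interval has to be bounded (\<open>Euler_powers_difference\<close>).

  \<^item> \<open>P\<^sup>2 - G = - P (1 - P) (1 - G) / 2\<close> for the step \<open>P = (1 + (\<tau> / 2) H)\<^sup>-\<^sup>1\<close>. Thus halving the step size
    of the Euler scheme changes its result by at most a multiple of \<open>1 / \<surd>n\<close>. The errors of
    repeated halving form a convergent geometric series, and the limit is \<open>e\<^sup>-\<^sup>t\<^sup>H\<close>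
    (\<open>Euler_semigroup_error\<close>).

The three bounds are of order \<open>n\<^sup>-\<^sup>1\<^sup>/\<^sup>2\<close>, which is at most \<open>n\<^sup>-\<^sup>1\<^sup>/\<^sup>3\<close>.\<close>

section \<open>Complex Hilbert spaces\<close>

lemma cinner_add_left: "cinner (x + y) z = cinner x z + cinner y (z::'a::complex_hilbert_space)"
  by (metis cinner_commute cinner_add_right complex_cnj_add)

lemma cinner_scaleC_left:
  "cinner (c *\<^sub>C x) y = cnj c * cinner x (y::'a::complex_hilbert_space)"
  by (metis cinner_commute cinner_scaleC_right complex_cnj_mult)

lemma scaleC_one [simp]: "1 *\<^sub>C (x::'a::complex_hilbert_space) = x"
  using scaleR_scaleC[of 1 x] by simp

lemma scaleC_zero_left [simp]: "0 *\<^sub>C (x::'a::complex_hilbert_space) = 0"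
  using scaleR_scaleC[of 0 x] by simp

lemma scaleC_zero_right [simp]: "c *\<^sub>C (0::'a::complex_hilbert_space) = 0"
  using scaleC_add_right[of c 0 0] by simp

lemma scaleC_minus_right: "c *\<^sub>C (- x) = - (c *\<^sub>C (x::'a::complex_hilbert_space))"
  by (metis add.right_inverse add_eq_0_iff2 scaleC_add_right scaleC_zero_right)

lemma scaleC_diff_right:
  "c *\<^sub>C (x - y) = c *\<^sub>C x - c *\<^sub>C (y::'a::complex_hilbert_space)"
  using scaleC_add_right[of c x "- y"] by (simp add: scaleC_minus_right)

lemma scaleC_minus_left: "(- c) *\<^sub>C x = - (c *\<^sub>C (x::'a::complex_hilbert_space))"
  by (metis add.right_inverse add_eq_0_iff2 scaleC_add_left scaleC_zero_left)

lemma scaleC_diff_left: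
  "(c - d) *\<^sub>C x = c *\<^sub>C x - d *\<^sub>C (x::'a::complex_hilbert_space)"
  using scaleC_add_left[of c "- d" x] by (simp add: scaleC_minus_left)

lemma scaleC_scaleR_commute:
  "c *\<^sub>C r *\<^sub>R x = r *\<^sub>R c *\<^sub>C (x::'a::complex_hilbert_space)"
  by (simp add: scaleR_scaleC scaleC_scaleC mult.commute)

lemma cinner_zero_right [simp]: "cinner x (0::'a::complex_hilbert_space) = 0"
  using cinner_scaleC_right[of x 0 0] by simp

lemma cinner_zero_left [simp]: "cinner 0 (x::'a::complex_hilbert_space) = 0"
  using cinner_scaleC_left[of 0 0 x] by simp

lemma cinner_minus_right: "cinner x (- y) = - cinner x (y::'a::complex_hilbert_space)"
  by (metis add.right_inverse add_eq_0_iff2 cinner_add_right cinner_zero_right)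

lemma cinner_diff_right:
  "cinner x (y - z) = cinner x y - cinner x (z::'a::complex_hilbert_space)"
  using cinner_add_right[of x y "- z"] by (simp add: cinner_minus_right)

lemma cinner_diff_left:
  "cinner (x - y) z = cinner x z - cinner y (z::'a::complex_hilbert_space)"
  by (metis cinner_commute cinner_diff_right complex_cnj_diff)

lemma cinner_scaleR_right:
  "cinner x (r *\<^sub>R y) = complex_of_real r * cinner x (y::'a::complex_hilbert_space)"
  by (simp add: scaleR_scaleC cinner_scaleC_right)

lemma cinner_scaleR_left:
  "cinner (r *\<^sub>R x) y = complex_of_real r * cinner x (y::'a::complex_hilbert_space)"
  by (simp add: scaleR_scaleC cinner_scaleC_left)

lemma scaleC_sum_right:
  "c *\<^sub>C (\<Sum>i\<in>I. f i) = (\<Sum>i\<in>I. c *\<^sub>C (f i::'a::complex_hilbert_space))"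
  by (induction I rule: infinite_finite_induct) (auto simp: scaleC_add_right)

lemma cinner_sum_right:
  "cinner x (\<Sum>i\<in>I. f i) = (\<Sum>i\<in>I. cinner x (f i::'a::complex_hilbert_space))"
  by (induction I rule: infinite_finite_induct) (auto simp: cinner_add_right)

lemma cinner_sum_left:
  "cinner (\<Sum>i\<in>I. f i) x = (\<Sum>i\<in>I. cinner (f i) (x::'a::complex_hilbert_space))"
  by (induction I rule: infinite_finite_induct) (auto simp: cinner_add_left)

lemma norm_scaleC: "norm (c *\<^sub>C x) = cmod c * norm (x::'a::complex_hilbert_space)"
proof -
  have "complex_of_real ((norm (c *\<^sub>C x))\<^sup>2) = c * cnj c * complex_of_real ((norm x)\<^sup>2)"
    by (simp only: cinner_self[symmetric] cinner_scaleC_left cinner_scaleC_right mult_ac)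
  also have "\<dots> = complex_of_real ((cmod c * norm x)\<^sup>2)"
    by (simp add: complex_norm_square power_mult_distrib flip: of_real_power)
  finally have "(norm (c *\<^sub>C x))\<^sup>2 = (cmod c * norm x)\<^sup>2"
    using of_real_eq_iff by blast
  then show ?thesis
    by (simp add: power2_eq_iff_nonneg)
qed

lemma cinner_Cauchy_Schwarz:
  "cmod (cinner x y) \<le> norm x * norm (y::'a::complex_hilbert_space)"
proof (cases "y = 0")
  case False
  define a where "a = cinner y x"
  define r where "r = (norm y)\<^sup>2"
  have xy: "cinner x y = cnj a"
    unfolding a_def by (rule cinner_commute)
  have r: "r > 0"
    using False by (simp add: r_def)
  let ?w = "r *\<^sub>R x - a *\<^sub>C y"
  have "cinner ?w ?w
      = complex_of_real r * complex_of_real r * cinner x x - complex_of_real r * a * cinner x y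
        - cnj a * complex_of_real r * cinner y x + cnj a * a * cinner y y"
    by (simp add: cinner_diff_left cinner_diff_right cinner_scaleR_left cinner_scaleR_right
        cinner_scaleC_left cinner_scaleC_right algebra_simps)
  also have "\<dots> = complex_of_real r * (complex_of_real r * cinner x x - a * cnj a)"
    by (simp add: xy a_def[symmetric] cinner_self[of y] r_def[symmetric] algebra_simps)
  also have "\<dots> = complex_of_real (r * (r * (norm x)\<^sup>2 - (cmod a)\<^sup>2))"
    by (simp add: cinner_self[of x] complex_norm_square[of a] del: of_real_power)
  finally have "(norm ?w)\<^sup>2 = r * (r * (norm x)\<^sup>2 - (cmod a)\<^sup>2)"
    by (simp add: cinner_self del: of_real_power of_real_mult of_real_diff)
  then have "0 \<le> r * (r * (norm x)\<^sup>2 - (cmod a)\<^sup>2)"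
    by (metis zero_le_power2)
  then have "(cmod a)\<^sup>2 \<le> (norm y)\<^sup>2 * (norm x)\<^sup>2"
    using r by (simp add: zero_le_mult_iff r_def)
  then have "(cmod a)\<^sup>2 \<le> (norm x * norm y)\<^sup>2"
    by (simp add: power_mult_distrib mult.commute)
  then have "cmod a \<le> norm x * norm y"
    by (rule power2_le_imp_le) simp
  then show ?thesis
    by (simp add: xy)
qed simp

section \<open>The finite Fourier transform\<close>

lemma roots_of_unity_orthogonal:
  assumes "k < M" "l < M"
  defines "\<omega> \<equiv> cis (2 * pi / real M)"
  shows "(\<Sum>j<M. cnj (\<omega> ^ (j * k)) * \<omega> ^ (j * l)) = (if k = l then of_nat M else 0)"
proof -
  define z where "z = cnj (\<omega> ^ k) * \<omega> ^ l"
  have unit: "cnj (\<omega> ^ m) * \<omega> ^ m = 1" for m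
    by (metis \<omega>_def complex_norm_square mult.commute norm_cis norm_power of_real_1 power_one)
  have summand: "cnj (\<omega> ^ (j * k)) * \<omega> ^ (j * l) = z ^ j" for j
    by (simp add: z_def power_mult_distrib mult.commute flip: power_mult)
  show ?thesis
  proof (cases "k = l")
    case True
    then have "z = 1" by (simp only: z_def unit)
    then show ?thesis
      unfolding summand using True by simp
  next
    case False
    have pow: "\<omega> ^ m = cis (2 * pi * real m / real M)" for m
      by (simp add: \<omega>_def Complex.DeMoivre field_simps)
    have "\<omega> ^ k \<noteq> \<omega> ^ l"
      using Complex.bij_betw_roots_unity[of M] assms(1,2) False
      by (auto simp: pow bij_betw_def inj_on_def)
    then have "z \<noteq> 1"
      by (metis unit z_def mult.commute mult.assoc mult.right_neutral mult_1)
    moreover have "\<omega> ^ M = 1"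
      unfolding pow using assms(1) by simp
    then have "(\<omega> ^ m) ^ M = 1" for m
      by (simp flip: power_mult) (simp add: mult.commute[of m] power_mult)
    then have "z ^ M = 1"
      by (simp add: z_def power_mult_distrib flip: complex_cnj_power)
    ultimately show ?thesis
      unfolding summand using False by (simp add: geometric_sum)
  qed
qed

lemma discrete_Parseval:
  fixes v :: "nat \<Rightarrow> 'a::complex_hilbert_space"
  defines "\<omega> \<equiv> \<lambda>M::nat. cis (2 * pi / real M)"
  shows "(\<Sum>j<M. (norm (\<Sum>k<M. \<omega> M ^ (j * k) *\<^sub>C v k))\<^sup>2) = real M * (\<Sum>k<M. (norm (v k))\<^sup>2)"
proof -
  let ?\<omega> = "\<omega> M"
  have "complex_of_real (\<Sum>j<M. (norm (\<Sum>k<M. ?\<omega> ^ (j * k) *\<^sub>C v k))\<^sup>2)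
      = (\<Sum>j<M. \<Sum>k<M. \<Sum>l<M. cnj (?\<omega> ^ (j * k)) * ?\<omega> ^ (j * l) * cinner (v k) (v l))"
    by (simp add: cinner_self[symmetric] cinner_sum_left cinner_sum_right cinner_scaleC_left
        cinner_scaleC_right sum_distrib_left mult_ac del: of_real_power)
      (rule sum.cong[OF refl], rule sum.swap)
  also have "\<dots> = (\<Sum>k<M. \<Sum>l<M. (\<Sum>j<M. cnj (?\<omega> ^ (j * k)) * ?\<omega> ^ (j * l)) * cinner (v k) (v l))"
    by (subst sum.swap, rule sum.cong[OF refl], subst sum.swap) (simp add: sum_distrib_right)
  also have "\<dots> = (\<Sum>k<M. \<Sum>l<M. (if k = l then of_nat M else 0) * cinner (v k) (v l))"
    by (intro sum.cong refl) (simp add: roots_of_unity_orthogonal \<omega>_def del: complex_cnj_power)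
  also have "\<dots> = (\<Sum>k<M. of_nat M * cinner (v k) (v k))"
    by (intro sum.cong refl) (simp add: if_distrib[of "\<lambda>x. x * _"] cong: if_cong)
  also have "\<dots> = complex_of_real (real M * (\<Sum>k<M. (norm (v k))\<^sup>2))"
    by (simp add: cinner_self sum_distrib_left del: of_real_power)
  finally show ?thesis
    using of_real_eq_iff by blast
qed

section \<open>Power decay of contractions\<close>

lemma contractionI:
  fixes A :: "'a::complex_hilbert_space \<Rightarrow> 'a"
  assumes "\<And>x y. A (x + y) = A x + A y" "\<And>c x. A (c *\<^sub>C x) = c *\<^sub>C A x"
    and "\<And>x. norm (A x) \<le> norm x"
  shows "contraction A"
  unfolding contraction_def bounded_clinear_def
proof (intro conjI allI)
  show "bounded_linear A"
    by (rule bounded_linear_intro[where K = 1]) (use assms in \<open>auto simp: scaleR_scaleC\<close>)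
  show "onorm A \<le> 1"
    by (rule onorm_bound) (use assms in auto)
qed (use assms in auto)

context
  fixes A :: "'a::complex_hilbert_space \<Rightarrow> 'a"
  assumes A: "contraction A"
begin

lemma contraction_bounded_linear: "bounded_linear A"
  using A by (simp add: contraction_def bounded_clinear_def)

lemmas contraction_linear_simps =
  linear_add[OF bounded_linear.linear[OF contraction_bounded_linear]]
  linear_diff[OF bounded_linear.linear[OF contraction_bounded_linear]]
  linear_scale[OF bounded_linear.linear[OF contraction_bounded_linear]]
  linear_neg[OF bounded_linear.linear[OF contraction_bounded_linear]]
  linear_0[OF bounded_linear.linear[OF contraction_bounded_linear]]
  linear_sum[OF bounded_linear.linear[OF contraction_bounded_linear]]

lemma contraction_scaleC: "A (c *\<^sub>C x) = c *\<^sub>C A x"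
  using A by (simp add: contraction_def bounded_clinear_def)

lemma contraction_norm: "norm (A x) \<le> norm x"
proof -
  have "norm (A x) \<le> onorm A * norm x"
    by (rule onorm[OF contraction_bounded_linear])
  also have "\<dots> \<le> 1 * norm x"
    using A by (intro mult_right_mono) (auto simp: contraction_def)
  finally show ?thesis by simp
qed

end

lemma contraction_compose:
  assumes "contraction A" "contraction B"
  shows "contraction (\<lambda>x. A (B x))"
  by (rule contractionI)
    (use assms in \<open>auto simp: contraction_linear_simps contraction_scaleC
        intro: order_trans[OF contraction_norm contraction_norm]\<close>)

lemma contraction_funpow: "contraction A \<Longrightarrow> contraction (A ^^ n)"
proof (induction n)
  case 0
  show ?case by (rule contractionI) auto
next
  case (Suc n)
  then show ?case
    using contraction_compose[of A "A ^^ n"] by (simp add: o_def)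
qed

lemma sum_squares_lower: "real N ^ 3 / 3 \<le> (\<Sum>k\<le>N. (real k)\<^sup>2)"
proof (induction N)
  case (Suc N)
  have "real (Suc N) ^ 3 / 3 \<le> real N ^ 3 / 3 + (real (Suc N))\<^sup>2"
    by (simp add: power3_eq_cube power2_eq_square field_simps)
  with Suc show ?case by simp
qed simp

text \<open>The hypothesis is a discrete maximal regularity bound in the frequency domain, and Parseval's
identity moves it to the time domain. Apply it to the sequence \<open>u k = \<phi> k F\<^sup>k x\<close>, where the tent
\<open>\<phi>\<close> rises with slope \<open>1\<close> on \<open>[0, n]\<close> and falls back to \<open>0\<close> at \<open>2 n\<close>. As \<open>u\<close> vanishes at
both ends it is a solution of \<open>u (k + 1) - F (u k) = d k\<close> on the cyclic group of order \<open>2 n\<close>, and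
the forcing term \<open>d k = (\<phi> (k + 1) - \<phi> k) F\<^sup>k\<^sup>+\<^sup>1 x\<close> has norm at most \<open>\<parallel>x\<parallel>\<close>. Hence
\<open>\<Sum> k\<^sup>2 \<parallel>(1 - F) F\<^sup>k x\<parallel>\<^sup>2\<close> over \<open>k \<le> n\<close> is at most \<open>2 n K\<^sup>2 \<parallel>x\<parallel>\<^sup>2\<close>. The norms
\<open>\<parallel>(1 - F) F\<^sup>k x\<parallel>\<close> decrease in \<open>k\<close> because \<open>F\<close> is a contraction, so the sum is at least
\<open>n\<^sup>3 / 3\<close> times the square of the last of them.\<close>

lemma Ritt_resolvent_imp_power_decay:
  fixes F :: "'a::complex_hilbert_space \<Rightarrow> 'a"
  assumes F: "contraction F" and K: "1 \<le> K"
    and res: "\<And>\<mu> x. cmod \<mu> = 1 \<Longrightarrow> norm (x - F x) \<le> K * norm (\<mu> *\<^sub>C x - F x)"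
  shows "norm ((F ^^ n) x - F ((F ^^ n) x)) \<le> 6 * K / (real n + 1) * norm x"
proof (cases "n = 0")
  case True
  have "norm (x - F x) \<le> norm x + norm x"
    using norm_triangle_ineq4[of x "F x"] contraction_norm[OF F, of x] by linarith
  also have "\<dots> \<le> 6 * K * norm x"
    using mult_right_mono[of 2 "6 * K" "norm x"] K by simp
  finally show ?thesis
    using True by simp
next
  case False
  note lin = contraction_linear_simps[OF F]
  define M where "M = 2 * n"
  define \<omega> where "\<omega> = cis (2 * pi / real M)"
  define \<phi> where "\<phi> k = min (real k) (real M - real k)" for k
  define u where "u k = \<phi> k *\<^sub>R (F ^^ k) x" for k
  define d where "d k = (\<phi> (Suc k) - \<phi> k) *\<^sub>R (F ^^ Suc k) x" for k
  define y where "y k = (F ^^ k) x - F ((F ^^ k) x)" for k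
  define v where "v j = (\<Sum>k<M. \<omega> ^ (j * k) *\<^sub>C u k)" for j
  have M: "M > 0" using False by (simp add: M_def)
  have u0: "u 0 = 0" "u M = 0"
    by (auto simp: u_def \<phi>_def)
  have F_u: "F (u k) = \<phi> k *\<^sub>R (F ^^ Suc k) x" for k
    by (simp add: u_def lin)
  have F_v: "F (v j) = (\<Sum>k<M. \<omega> ^ (j * k) *\<^sub>C F (u k))" for j
    by (simp add: v_def lin contraction_scaleC[OF F])
  (* Multiplication by the inverse of the j-th character shifts the sequence by one step; the
     boundary terms are 0 because u is 0 at both ends of the period. *)
  have shift: "cnj (\<omega> ^ j) *\<^sub>C v j = (\<Sum>k<M. \<omega> ^ (j * k) *\<^sub>C u (Suc k))" for j
  proof -
    obtain m where m: "M = Suc m" using M by (cases M) auto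
    have unit: "cnj (\<omega> ^ j) * \<omega> ^ j = 1"
      by (metis \<omega>_def complex_norm_square mult.commute norm_cis norm_power of_real_1 power_one)
    have "cnj (\<omega> ^ j) *\<^sub>C v j
        = (\<Sum>k<m. (cnj (\<omega> ^ j) * \<omega> ^ j * \<omega> ^ (j * k)) *\<^sub>C u (Suc k))"
      unfolding v_def m
      by (simp add: sum.lessThan_Suc_shift u0 scaleC_sum_right scaleC_scaleC power_add mult.assoc
          del: sum.lessThan_Suc)
    also have "\<dots> = (\<Sum>k<M. \<omega> ^ (j * k) *\<^sub>C u (Suc k))"
      using u0 by (simp only: unit m) simp
    finally show ?thesis .
  qed
  have eq: "cnj (\<omega> ^ j) *\<^sub>C v j - F (v j) = (\<Sum>k<M. \<omega> ^ (j * k) *\<^sub>C d k)" for j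
    unfolding shift F_v F_u sum_subtractf[symmetric] scaleC_diff_right[symmetric]
    by (simp only: u_def d_def scaleR_diff_left)
  have diff: "v j - F (v j) = (\<Sum>k<M. \<omega> ^ (j * k) *\<^sub>C (\<phi> k *\<^sub>R y k))" for j
    unfolding F_v F_u unfolding v_def sum_subtractf[symmetric] scaleC_diff_right[symmetric]
    by (simp add: u_def y_def scaleR_diff_right)
  have d_le: "norm (d k) \<le> norm x" for k
  proof -
    have "norm (d k) \<le> 1 * norm x"
      unfolding d_def norm_scaleR
      by (intro mult_mono contraction_norm[OF contraction_funpow[OF F]]) (auto simp: \<phi>_def)
    then show ?thesis by simp
  qed
  have "real M * (\<Sum>k<M. (norm (\<phi> k *\<^sub>R y k))\<^sup>2) = (\<Sum>j<M. (norm (v j - F (v j)))\<^sup>2)"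
    unfolding diff unfolding \<omega>_def discrete_Parseval by (rule refl)
  also have "\<dots> \<le> (\<Sum>j<M. K\<^sup>2 * (norm (cnj (\<omega> ^ j) *\<^sub>C v j - F (v j)))\<^sup>2)"
    unfolding power_mult_distrib[symmetric]
    by (intro sum_mono power_mono res) (auto simp: norm_power \<omega>_def)
  also have "\<dots> = K\<^sup>2 * (\<Sum>j<M. (norm (cnj (\<omega> ^ j) *\<^sub>C v j - F (v j)))\<^sup>2)"
    by (rule sum_distrib_left[symmetric])
  also have "\<dots> = K\<^sup>2 * (real M * (\<Sum>k<M. (norm (d k))\<^sup>2))"
    unfolding eq unfolding \<omega>_def discrete_Parseval by (rule refl)
  also have "\<dots> \<le> K\<^sup>2 * (real M * (\<Sum>k<M. (norm x)\<^sup>2))"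
    by (intro mult_left_mono sum_mono power_mono d_le) auto
  finally have "(\<Sum>k<M. (norm (\<phi> k *\<^sub>R y k))\<^sup>2) \<le> K\<^sup>2 * (real M * (norm x)\<^sup>2)"
    using M by (simp add: mult.left_commute)
  moreover have "real n ^ 3 / 3 * (norm (y n))\<^sup>2 \<le> (\<Sum>k<M. (norm (\<phi> k *\<^sub>R y k))\<^sup>2)"
  proof -
    have mono: "norm (y n) \<le> norm (y k)" if "k \<le> n" for k
    proof -
      have pow: "(F ^^ (n - k)) ((F ^^ k) x) = (F ^^ n) x"
        using that by (metis funpow_add comp_apply le_add_diff_inverse2)
      have "(F ^^ (n - k)) (y k) = y n"
        unfolding y_def contraction_linear_simps[OF contraction_funpow[OF F]]
        by (simp only: pow flip: funpow_swap1)
      then have "y n = (F ^^ (n - k)) (y k)" ..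
      then show ?thesis
        using contraction_norm[OF contraction_funpow[OF F]] by (metis (no_types))
    qed
    have "real n ^ 3 / 3 * (norm (y n))\<^sup>2 \<le> (\<Sum>k\<le>n. (real k)\<^sup>2) * (norm (y n))\<^sup>2"
      by (intro mult_right_mono sum_squares_lower) auto
    also have "\<dots> = (\<Sum>k\<le>n. (real k * norm (y n))\<^sup>2)"
      by (simp add: sum_distrib_right power_mult_distrib)
    also have "\<dots> \<le> (\<Sum>k\<le>n. (norm (\<phi> k *\<^sub>R y k))\<^sup>2)"
      by (intro sum_mono power_mono) (auto simp: \<phi>_def M_def intro!: mult_mono mono)
    also have "\<dots> \<le> (\<Sum>k<M. (norm (\<phi> k *\<^sub>R y k))\<^sup>2)"
      by (intro sum_mono2) (use False in \<open>auto simp: M_def\<close>)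
    finally show ?thesis .
  qed
  (* The result with constant sqrt 6 K / n; it is rounded up to 3 K / n, and n + 1 \<le> 2 n turns the
     denominator into n + 1, which is harmless at n = 0. *)
  ultimately have "real n ^ 3 / 3 * (norm (y n))\<^sup>2 \<le> K\<^sup>2 * (real M * (norm x)\<^sup>2)"
    by linarith
  then have "real n * ((real n * norm (y n))\<^sup>2) \<le> real n * (6 * (K * norm x)\<^sup>2)"
    by (simp add: M_def power_mult_distrib power3_eq_cube power2_eq_square mult_ac)
  then have "(real n * norm (y n))\<^sup>2 \<le> 6 * (K * norm x)\<^sup>2"
    using False by simp
  also have "\<dots> \<le> (3 * (K * norm x))\<^sup>2"
    by (simp add: power_mult_distrib)
  finally have "real n * norm (y n) \<le> 3 * (K * norm x)"
    by (rule power2_le_imp_le) (use K in simp)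
  moreover have "(real n + 1) * norm (y n) \<le> 2 * (real n * norm (y n))"
    using False mult_right_mono[of "real n + 1" "2 * real n" "norm (y n)"] by simp
  ultimately have "(real n + 1) * norm (y n) \<le> 6 * (K * norm x)"
    by linarith
  then show ?thesis
    unfolding y_def[of n, symmetric] by (simp add: field_simps)
qed

section \<open>Differences of powers\<close>

lemma sum_inverse_le_sqrt: "(\<Sum>k<n. 1 / (real k + 1)) \<le> 2 * sqrt (real n)"
proof (induction n)
  case (Suc n)
  define p q where "p = sqrt (real n)" and "q = sqrt (real n + 1)"
  have pq: "p \<le> q" "0 \<le> p" "1 \<le> q" "q\<^sup>2 = real n + 1" "p\<^sup>2 = real n"
    by (auto simp: p_def q_def)
  have "q * 1 \<le> q * q"
    using pq by (intro mult_left_mono) auto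
  with pq have sum: "q + p \<le> 2 * (q * q)"
    by linarith
  have "1 = (q - p) * (q + p)"
    using pq by (simp add: algebra_simps power2_eq_square)
  also have "\<dots> \<le> (q - p) * (2 * (q * q))"
    using pq sum by (intro mult_left_mono) auto
  also have "\<dots> = 2 * (q - p) * (real n + 1)"
    unfolding pq(4)[symmetric] by (simp add: power2_eq_square)
  finally have "1 / (real n + 1) \<le> 2 * (q - p)"
    by (simp add: pos_divide_le_eq)
  with Suc show ?case
    by (simp add: p_def q_def algebra_simps)
qed simp

text \<open>By partial fractions the sum is \<open>2 / (n + 1)\<close> times a harmonic sum, so it is of order
\<open>ln n / n\<close>; the power \<open>n\<^sup>-\<^sup>1\<^sup>/\<^sup>2\<close> is a convenient upper bound that is summable along powers of two.\<close>

lemma convolution_of_reciprocals_le: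
  assumes "n \<ge> 1"
  shows "(\<Sum>k<n. 1 / ((real (n - 1 - k) + 1) * (real k + 1))) \<le> 4 / sqrt (real n)"
proof -
  have "(\<Sum>k<n. 1 / ((real (n - 1 - k) + 1) * (real k + 1)))
      = (\<Sum>k<n. (1 / (real (n - Suc k) + 1) + 1 / (real k + 1)) / (real n + 1))"
  proof (intro sum.cong refl)
    fix k assume "k \<in> {..<n}"
    then have sum: "(real (n - Suc k) + 1) + (real k + 1) = real n + 1"
      by (simp add: of_nat_diff)
    have "1 / (p * q) = (1 / p + 1 / q) / (p + q)" if "p > 0" "q > 0" for p q :: real
    proof -
      have "1 / p + 1 / q = (p + q) / (p * q)"
        using that by (simp add: field_simps)
      then show ?thesis
        using that by simp
    qed
    from this[of "real (n - Suc k) + 1" "real k + 1"]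
    show "1 / ((real (n - 1 - k) + 1) * (real k + 1))
        = (1 / (real (n - Suc k) + 1) + 1 / (real k + 1)) / (real n + 1)"
      unfolding sum by simp
  qed
  also have "\<dots> = ((\<Sum>k<n. 1 / (real (n - Suc k) + 1)) + (\<Sum>k<n. 1 / (real k + 1))) / (real n + 1)"
    by (simp add: sum_divide_distrib[symmetric] sum.distrib)
  also have "(\<Sum>k<n. 1 / (real (n - Suc k) + 1)) = (\<Sum>k<n. 1 / (real k + 1))"
    by (rule sum.nat_diff_reindex)
  also have "((\<Sum>k<n. 1 / (real k + 1)) + (\<Sum>k<n. 1 / (real k + 1))) / (real n + 1)
      \<le> (4 * sqrt (real n)) / real n"
    using sum_inverse_le_sqrt[of n] assms
    by (intro frac_le) (auto intro!: add_nonneg_nonneg sum_nonneg)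
  also have "\<dots> = 4 / sqrt (real n)"
    using assms by (simp add: field_simps)
  finally show ?thesis .
qed

lemma funpow_difference_telescope:
  fixes U V :: "'a::real_vector \<Rightarrow> 'a"
  assumes "linear U"
  shows "(U ^^ n) x - (V ^^ n) x
       = (\<Sum>k<n. (U ^^ (n - 1 - k)) (U ((V ^^ k) x) - V ((V ^^ k) x)))"
proof (induction n)
  case (Suc n)
  let ?w = "\<lambda>k. U ((V ^^ k) x) - V ((V ^^ k) x)"
  have "(U ^^ Suc n) x - (V ^^ Suc n) x = U ((U ^^ n) x - (V ^^ n) x) + ?w n"
    by (simp add: linear_diff[OF assms])
  also have "\<dots> = (\<Sum>k<n. (U ^^ Suc (n - 1 - k)) (?w k)) + ?w n"
    by (simp add: Suc linear_sum[OF assms] del: One_nat_def)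
  also have "(\<Sum>k<n. (U ^^ Suc (n - 1 - k)) (?w k)) = (\<Sum>k<n. (U ^^ (n - k)) (?w k))"
    by (intro sum.cong refl) (metis Suc_diff_Suc diff_Suc_eq_diff_pred lessThan_iff One_nat_def)
  finally show ?case by simp
qed simp

text \<open>The comparison principle behind all estimates below. Plain telescoping of \<open>U\<^sup>n - V\<^sup>n\<close> loses a factor
\<open>n\<close>. If \<open>U - V\<close> contains a factor \<open>X\<close> that is smoothed by the powers of \<open>U\<close> on its left and a
factor \<open>Y\<close> that is smoothed by the powers of \<open>V\<close> on its right, then the terms decay like
\<open>1 / ((n - k) (k + 1))\<close>, and the sum is small.\<close>

lemma funpow_difference_le:
  fixes U V X Y E :: "'a::real_normed_vector \<Rightarrow> 'a"
  assumes U: "linear U" and n: "n \<ge> 1" and nonneg: "0 \<le> a" "0 \<le> d"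
    and factor: "\<And>z. U z - V z = X (E (Y z))"
    and left: "\<And>j z. j < n \<Longrightarrow> norm ((U ^^ j) (X z)) \<le> a / (real j + 1) * norm z"
    and mid: "\<And>z. norm (E z) \<le> d * norm z"
    and right: "\<And>k. k < n \<Longrightarrow> norm (Y ((V ^^ k) x)) \<le> b / (real k + 1) * norm x"
  shows "norm ((U ^^ n) x - (V ^^ n) x) \<le> 4 * (a * d * b) / sqrt (real n) * norm x"
proof -
  have b: "0 \<le> b * norm x"
    using right[of 0] n by (auto intro: order_trans[OF norm_ge_zero])
  have "norm ((U ^^ n) x - (V ^^ n) x)
      \<le> (\<Sum>k<n. norm ((U ^^ (n - 1 - k)) (X (E (Y ((V ^^ k) x))))))"
    unfolding funpow_difference_telescope[OF U] factor by (rule norm_sum)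
  also have "\<dots> \<le> (\<Sum>k<n. a * d * (b * norm x) * (1 / ((real (n - 1 - k) + 1) * (real k + 1))))"
  proof (rule sum_mono)
    fix k assume k: "k \<in> {..<n}"
    have "norm ((U ^^ (n - 1 - k)) (X (E (Y ((V ^^ k) x)))))
        \<le> a / (real (n - 1 - k) + 1) * norm (E (Y ((V ^^ k) x)))"
      using k n by (intro left) auto
    also have "\<dots> \<le> a / (real (n - 1 - k) + 1) * (d * (b / (real k + 1) * norm x))"
      using k nonneg by (intro mult_left_mono order_trans[OF mid] right) auto
    finally show "norm ((U ^^ (n - 1 - k)) (X (E (Y ((V ^^ k) x)))))
        \<le> a * d * (b * norm x) * (1 / ((real (n - 1 - k) + 1) * (real k + 1)))"
      by simp
  qed
  also have "\<dots> \<le> a * d * (b * norm x) * (4 / sqrt (real n))"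
    unfolding sum_distrib_left[symmetric]
    by (intro mult_left_mono convolution_of_reciprocals_le n mult_nonneg_nonneg nonneg b)
  finally show ?thesis by (simp add: mult_ac)
qed

section \<open>Sectorial operators and their implicit Euler steps\<close>

text \<open>The operator \<open>(1 + \<tau> A)\<^sup>-\<^sup>1\<close>, expressed by the resolvent at \<open>1 / \<tau>\<close>.\<close>

definition implicit_Euler ::
    "'a::complex_hilbert_space set \<Rightarrow> ('a \<Rightarrow> 'a) \<Rightarrow> real \<Rightarrow> 'a \<Rightarrow> 'a" where
  "implicit_Euler D A \<tau> y = shifted_inverse D A (complex_of_real (1 / \<tau>)) (y /\<^sub>R \<tau>)"

text \<open>The inequality \<open>form\<close> says that the numerical range lies in the closed sector with vertex \<open>0\<close> whose
semi-angle has cosine \<open>c\<close>; this way of writing it is invariant under scaling of \<open>x\<close> and does not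
refer to arguments of complex numbers.\<close>

locale sectorial_operator =
  fixes D :: "'a::complex_hilbert_space set" and A :: "'a \<Rightarrow> 'a" and c :: real
  assumes linear: "linear_operator D A"
    and c_pos: "0 < c"
    and form: "\<And>x. x \<in> D \<Longrightarrow> c * cmod (cinner x (A x)) \<le> Re (cinner x (A x))"
    and onto: "\<And>z y. 0 < z \<Longrightarrow> \<exists>x\<in>D. z *\<^sub>R x + A x = y"
begin

lemma dom_add: "x \<in> D \<Longrightarrow> y \<in> D \<Longrightarrow> x + y \<in> D"
  and op_add: "x \<in> D \<Longrightarrow> y \<in> D \<Longrightarrow> A (x + y) = A x + A y"
  and dom_scaleC: "x \<in> D \<Longrightarrow> a *\<^sub>C x \<in> D"
  and op_scaleC: "x \<in> D \<Longrightarrow> A (a *\<^sub>C x) = a *\<^sub>C A x"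
  using linear by (auto simp: linear_operator_def)

lemma op_scaleR: "x \<in> D \<Longrightarrow> A (r *\<^sub>R x) = r *\<^sub>R A x"
  by (simp add: scaleR_scaleC op_scaleC)

lemma op_minus: "x \<in> D \<Longrightarrow> - x \<in> D \<and> A (- x) = - A x"
  using dom_scaleC[of x "-1"] op_scaleC[of x "-1"] by (simp add: scaleC_minus_left)

lemma dom_diff: "x \<in> D \<Longrightarrow> y \<in> D \<Longrightarrow> x - y \<in> D"
  and op_diff: "x \<in> D \<Longrightarrow> y \<in> D \<Longrightarrow> A (x - y) = A x - A y"
  using dom_add[of x "- y"] op_add[of x "- y"] op_minus[of y] by auto

text \<open>A number \<open>a\<close> of the sector and a number \<open>w\<close> of the right half-plane cannot cancel:
\<open>\<bar>w + a\<bar> \<ge> Re (w + a) \<ge> Re a \<ge> c \<bar>a\<bar>\<close>, hence \<open>\<bar>w\<bar> \<le> (1 + 1 / c) \<bar>w + a\<bar>\<close>.\<close>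

lemma norm_shift_lower:
  assumes x: "x \<in> D" and \<eta>: "0 \<le> Re \<eta>"
  shows "cmod \<eta> * norm x \<le> (1 + 1 / c) * norm (\<eta> *\<^sub>C x + A x)"
proof (cases "x = 0")
  case False
  define a where "a = cinner x (A x)"
  define w where "w = \<eta> * complex_of_real ((norm x)\<^sup>2)"
  have inner: "cinner x (\<eta> *\<^sub>C x + A x) = w + a"
    by (simp add: cinner_add_right cinner_scaleC_right cinner_self a_def w_def)
  have "c * cmod a \<le> Re a"
    using form[OF x] by (simp add: a_def)
  also have "Re a \<le> Re (w + a)"
    using \<eta> by (simp add: w_def flip: of_real_power)
  also have "\<dots> \<le> cmod (w + a)"
    by (rule complex_Re_le_cmod)
  finally have "cmod a \<le> cmod (w + a) / c"
    using c_pos by (simp add: field_simps)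
  then have "cmod w \<le> (1 + 1 / c) * cmod (w + a)"
    using norm_triangle_ineq4[of "w + a" a] by (simp add: algebra_simps)
  also have "\<dots> \<le> (1 + 1 / c) * (norm x * norm (\<eta> *\<^sub>C x + A x))"
    unfolding inner[symmetric]
    by (intro mult_left_mono cinner_Cauchy_Schwarz) (use c_pos in auto)
  finally have "norm x * (cmod \<eta> * norm x) \<le> norm x * ((1 + 1 / c) * norm (\<eta> *\<^sub>C x + A x))"
    by (simp add: w_def norm_mult power2_eq_square mult_ac)
  then show ?thesis
    using False by simp
qed (use c_pos in simp)

lemma norm_shift_real_lower:
  assumes x: "x \<in> D"
  shows "z * norm x \<le> norm (z *\<^sub>R x + A x)"
proof (cases "x = 0")
  case False
  have "0 \<le> Re (cinner x (A x))"
    using form[OF x] c_pos by (meson mult_nonneg_nonneg norm_ge_zero less_imp_le order_trans)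
  then have "z * (norm x)\<^sup>2 \<le> Re (cinner x (z *\<^sub>R x + A x))"
    by (simp add: cinner_add_right cinner_scaleR_right cinner_self flip: of_real_power)
  also have "\<dots> \<le> norm x * norm (z *\<^sub>R x + A x)"
    by (rule order_trans[OF complex_Re_le_cmod cinner_Cauchy_Schwarz])
  finally have "norm x * (z * norm x) \<le> norm x * norm (z *\<^sub>R x + A x)"
    by (simp add: power2_eq_square mult_ac)
  then show ?thesis
    using False by simp
qed simp

lemma shift_inj:
  assumes "0 < z" "x \<in> D" "y \<in> D" "z *\<^sub>R x + A x = z *\<^sub>R y + A y"
  shows "x = y"
  using norm_shift_real_lower[of "x - y" z] assms
  by (simp add: dom_diff op_diff scaleR_diff_right algebra_simps mult_le_0_iff)

lemma resolvent_eq: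
  assumes "0 < z"
  shows "shifted_inverse D A (complex_of_real z) y \<in> D"
    and "z *\<^sub>R shifted_inverse D A (complex_of_real z) y + A (shifted_inverse D A (complex_of_real z) y) = y"
proof -
  let ?f = "\<lambda>x. complex_of_real z *\<^sub>C x + A x"
  have inj: "inj_on ?f D"
    by (rule inj_onI) (use shift_inj[OF assms] in \<open>auto simp flip: scaleR_scaleC\<close>)
  have y: "y \<in> ?f ` D"
    using onto[OF assms, of y] by (force simp flip: scaleR_scaleC)
  show "shifted_inverse D A (complex_of_real z) y \<in> D"
    unfolding shifted_inverse_def by (rule the_inv_into_into[OF inj y subset_refl])
  show "z *\<^sub>R shifted_inverse D A (complex_of_real z) y + A (shifted_inverse D A (complex_of_real z) y) = y"
    unfolding shifted_inverse_def scaleR_scaleC by (rule f_the_inv_into_f[OF inj y])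
qed

lemma resolvent_unique:
  assumes "0 < z" "x \<in> D" "z *\<^sub>R x + A x = y"
  shows "shifted_inverse D A (complex_of_real z) y = x"
  by (rule shift_inj[OF assms(1) resolvent_eq(1)[OF assms(1)] assms(2)])
    (simp only: resolvent_eq(2)[OF assms(1)] assms(3))

lemma Euler_eq:
  assumes "0 < \<tau>"
  shows "implicit_Euler D A \<tau> y \<in> D"
    and "implicit_Euler D A \<tau> y + \<tau> *\<^sub>R A (implicit_Euler D A \<tau> y) = y"
proof -
  let ?g = "implicit_Euler D A \<tau> y"
  have pos: "0 < 1 / \<tau>" using assms by simp
  show "?g \<in> D"
    unfolding implicit_Euler_def by (rule resolvent_eq[OF pos])
  have "(1 / \<tau>) *\<^sub>R ?g + A ?g = y /\<^sub>R \<tau>"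
    unfolding implicit_Euler_def by (rule resolvent_eq[OF pos])
  then have "\<tau> *\<^sub>R ((1 / \<tau>) *\<^sub>R ?g + A ?g) = \<tau> *\<^sub>R (y /\<^sub>R \<tau>)"
    by simp
  then show "?g + \<tau> *\<^sub>R A ?g = y"
    using assms by (simp add: scaleR_add_right)
qed

lemma Euler_unique:
  assumes "0 < \<tau>" "x \<in> D" "x + \<tau> *\<^sub>R A x = y"
  shows "implicit_Euler D A \<tau> y = x"
  unfolding implicit_Euler_def
proof (rule resolvent_unique)
  show "(1 / \<tau>) *\<^sub>R x + A x = y /\<^sub>R \<tau>"
    unfolding assms(3)[symmetric] using assms(1) by (simp add: scaleR_add_right divide_inverse)
qed (use assms in auto)

lemma Euler_contraction:
  assumes "0 < \<tau>"
  shows "contraction (implicit_Euler D A \<tau>)"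
proof (rule contractionI)
  note G = Euler_eq[OF assms]
  show "implicit_Euler D A \<tau> (x + y) = implicit_Euler D A \<tau> x + implicit_Euler D A \<tau> y" for x y
  proof (rule Euler_unique[OF assms])
    have "implicit_Euler D A \<tau> x + implicit_Euler D A \<tau> y
        + \<tau> *\<^sub>R A (implicit_Euler D A \<tau> x + implicit_Euler D A \<tau> y)
      = (implicit_Euler D A \<tau> x + \<tau> *\<^sub>R A (implicit_Euler D A \<tau> x))
        + (implicit_Euler D A \<tau> y + \<tau> *\<^sub>R A (implicit_Euler D A \<tau> y))"
      by (simp add: op_add G(1) scaleR_add_right)
    then show "implicit_Euler D A \<tau> x + implicit_Euler D A \<tau> y
        + \<tau> *\<^sub>R A (implicit_Euler D A \<tau> x + implicit_Euler D A \<tau> y) = x + y"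
      by (simp add: G(2))
  qed (simp add: dom_add G(1))
  show "implicit_Euler D A \<tau> (a *\<^sub>C x) = a *\<^sub>C implicit_Euler D A \<tau> x" for a x
  proof (rule Euler_unique[OF assms])
    have "a *\<^sub>C implicit_Euler D A \<tau> x + \<tau> *\<^sub>R A (a *\<^sub>C implicit_Euler D A \<tau> x)
        = a *\<^sub>C (implicit_Euler D A \<tau> x + \<tau> *\<^sub>R A (implicit_Euler D A \<tau> x))"
      by (simp add: op_scaleC G(1) scaleC_add_right scaleC_scaleR_commute)
    then show "a *\<^sub>C implicit_Euler D A \<tau> x + \<tau> *\<^sub>R A (a *\<^sub>C implicit_Euler D A \<tau> x) = a *\<^sub>C x"
      by (simp add: G(2))
  qed (simp add: dom_scaleC G(1))
  show "norm (implicit_Euler D A \<tau> x) \<le> norm x" for x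
  proof -
    have "(1 / \<tau>) * norm (implicit_Euler D A \<tau> x) \<le> norm (x /\<^sub>R \<tau>)"
      using norm_shift_real_lower[of "shifted_inverse D A (complex_of_real (1/\<tau>)) (x /\<^sub>R \<tau>)" "1 / \<tau>"]
        resolvent_eq[of "1 / \<tau>" "x /\<^sub>R \<tau>"] assms by (simp add: implicit_Euler_def del: of_real_divide)
    then show ?thesis
      using assms by (simp add: field_simps)
  qed
qed

text \<open>The constant that \<open>Ritt_resolvent_imp_power_decay\<close> yields for implicit Euler steps.\<close>

definition decay_constant :: real where
  "decay_constant = 6 * (2 + 1 / c)"

lemma decay_constant_pos: "0 < decay_constant"
  using c_pos by (simp add: decay_constant_def pos_add_strict)

text \<open>With \<open>v = G x\<close>, i.e. \<open>x = v + \<tau> A v\<close>, one has \<open>x - G x = \<tau> A v\<close> and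
\<open>\<mu> x - G x = \<mu> \<tau> (\<eta> v + A v)\<close> with \<open>\<eta> = (1 - cnj \<mu>) / \<tau>\<close>. For \<open>\<bar>\<mu>\<bar> = 1\<close> the number \<open>\<eta>\<close> is in
the closed right half-plane, so sectoriality bounds \<open>\<eta> v\<close>, and with it \<open>A v\<close>, by \<open>\<eta> v + A v\<close>.
The bound depends on neither \<open>\<tau>\<close> nor \<open>A\<close>, only on \<open>c\<close>.\<close>

lemma Euler_power_decay:
  assumes \<tau>: "0 < \<tau>"
  defines "G \<equiv> implicit_Euler D A \<tau>"
  shows "norm ((G ^^ n) x - G ((G ^^ n) x)) \<le> decay_constant / (real n + 1) * norm x"
  unfolding decay_constant_def
proof (rule Ritt_resolvent_imp_power_decay)
  show "contraction G"
    unfolding G_def by (rule Euler_contraction[OF \<tau>])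
  show "1 \<le> 2 + 1 / c"
    using c_pos by (simp add: add_nonneg_nonneg)
  show "norm (x - G x) \<le> (2 + 1 / c) * norm (\<mu> *\<^sub>C x - G x)" if \<mu>: "cmod \<mu> = 1" for \<mu> x
  proof -
    define v where "v = G x"
    have v: "v \<in> D" "x = v + \<tau> *\<^sub>R A v"
      using Euler_eq[OF \<tau>, of x] by (auto simp: v_def G_def)
    define \<eta> where "\<eta> = (1 - cnj \<mu>) / complex_of_real \<tau>"
    have unit: "\<mu> * cnj \<mu> = 1"
      using \<mu> complex_norm_square[of \<mu>] by simp
    have "Re \<mu> \<le> 1"
      using complex_Re_le_cmod[of \<mu>] \<mu> by simp
    then have \<eta>: "0 \<le> Re \<eta>"
      using \<tau> by (simp add: \<eta>_def Re_divide_of_real)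
    have "\<mu> * complex_of_real \<tau> * \<eta> = \<mu> - \<mu> * cnj \<mu>"
      using \<tau> by (simp add: \<eta>_def field_simps)
    then have coeff: "\<mu> * complex_of_real \<tau> * \<eta> = \<mu> - 1"
      by (simp only: unit)
    have "(\<mu> * complex_of_real \<tau>) *\<^sub>C (\<eta> *\<^sub>C v + A v) = (\<mu> - 1) *\<^sub>C v + \<mu> *\<^sub>C (\<tau> *\<^sub>R A v)"
      unfolding scaleC_add_right scaleC_scaleC scaleR_scaleC coeff by (rule refl)
    also have "\<dots> = \<mu> *\<^sub>C (v + \<tau> *\<^sub>R A v) - v"
      by (simp add: scaleC_diff_left scaleC_add_right)
    also have "\<dots> = \<mu> *\<^sub>C x - G x"
      unfolding v(2)[symmetric] unfolding v_def by (rule refl)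
    finally have "norm (\<mu> *\<^sub>C x - G x) = \<tau> * norm (\<eta> *\<^sub>C v + A v)"
      using \<tau> \<mu> by (metis norm_scaleC norm_mult mult_1 norm_of_real abs_of_pos)
    moreover have "norm (x - G x) \<le> \<tau> * (norm (\<eta> *\<^sub>C v + A v) + cmod \<eta> * norm v)"
    proof -
      have "x - G x = (v + \<tau> *\<^sub>R A v) - v"
        unfolding v(2)[symmetric] unfolding v_def by (rule refl)
      also have "\<dots> = \<tau> *\<^sub>R ((\<eta> *\<^sub>C v + A v) - \<eta> *\<^sub>C v)"
        by simp
      also have "norm \<dots> \<le> \<tau> * (norm (\<eta> *\<^sub>C v + A v) + norm (\<eta> *\<^sub>C v))"
        unfolding norm_scaleR using \<tau> by (intro mult_mono norm_triangle_ineq4) auto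
      finally show ?thesis by (simp add: norm_scaleC)
    qed
    moreover have "\<tau> * (norm (\<eta> *\<^sub>C v + A v) + cmod \<eta> * norm v)
        \<le> \<tau> * (norm (\<eta> *\<^sub>C v + A v) + (1 + 1 / c) * norm (\<eta> *\<^sub>C v + A v))"
      using norm_shift_lower[OF v(1) \<eta>] \<tau> by (intro mult_left_mono add_left_mono) auto
    ultimately show ?thesis
      by (simp add: algebra_simps)
  qed
qed

text \<open>Both steps are functions of the same operator. From \<open>P\<^sup>-\<^sup>1 = 1 + (\<tau> / 2) A\<close> and \<open>G\<^sup>-\<^sup>1 = 2 P\<^sup>-\<^sup>1 - 1\<close>
one gets \<open>P\<^sup>2 - G = - (1 - P)\<^sup>2 G = - P (1 - P) (1 - G) / 2\<close>, which has a smoothing factor for the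
powers of \<open>P\<close> and one for the powers of \<open>G\<close>.\<close>

lemma Euler_doubling:
  assumes \<tau>: "0 < \<tau>" and n: "n \<ge> 1"
  shows "norm ((implicit_Euler D A (\<tau> / 2) ^^ (2 * n)) x - (implicit_Euler D A \<tau> ^^ n) x)
       \<le> 2 * decay_constant\<^sup>2 / sqrt (real n) * norm x"
proof -
  define P where "P = implicit_Euler D A (\<tau> / 2)"
  define G where "G = implicit_Euler D A \<tau>"
  have \<tau>2: "0 < \<tau> / 2" using \<tau> by simp
  have P: "contraction P"
    unfolding P_def by (rule Euler_contraction[OF \<tau>2])
  note P_lin = contraction_linear_simps[OF P]
  have factor: "(P ^^ 2) z - G z = P ((- 1 / 2) *\<^sub>R (z - G z)) - P (P ((- 1 / 2) *\<^sub>R (z - G z)))" for z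
  proof -
    define w where "w = z - G z"
    have G: "G z \<in> D" "G z + \<tau> *\<^sub>R A (G z) = z"
      using Euler_eq[OF \<tau>, of z] by (auto simp: G_def)
    then have "w = \<tau> *\<^sub>R A (G z)"
      unfolding w_def by (metis add_diff_cancel_left')
    then have "P (G z + (1 / 2) *\<^sub>R w) = G z"
      unfolding P_def by (intro Euler_unique[OF \<tau>2] G(1)) simp
    then have PG: "P (G z) = G z - (1 / 2) *\<^sub>R P w"
      by (simp add: P_lin algebra_simps)
    have "P z = P (G z) + P w"
      by (simp add: w_def P_lin)
    also have "\<dots> = G z + (1 / 2) *\<^sub>R P w"
      unfolding PG by (simp add: algebra_simps flip: scaleR_add_left)
    finally have "P (P z) = G z - (1 / 2) *\<^sub>R P w + (1 / 2) *\<^sub>R P (P w)"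
      by (simp add: P_lin PG)
    then show ?thesis
      unfolding w_def[symmetric] by (simp add: P_lin numeral_2_eq_2)
  qed
  have "norm (((P ^^ 2) ^^ n) x - (G ^^ n) x)
      \<le> 4 * (decay_constant * (1 / 2) * decay_constant) / sqrt (real n) * norm x"
  proof (rule funpow_difference_le[where X = "\<lambda>w. P w - P (P w)" and Y = "\<lambda>z. z - G z"
        and E = "\<lambda>z. (- 1 / 2) *\<^sub>R z"])
    show "linear (P ^^ 2)"
      by (intro bounded_linear.linear contraction_bounded_linear contraction_funpow P)
    show "(P ^^ 2) z - G z = P ((- 1 / 2) *\<^sub>R (z - G z)) - P (P ((- 1 / 2) *\<^sub>R (z - G z)))" for z
      by (rule factor)
    show "norm (((P ^^ 2) ^^ j) (P z - P (P z))) \<le> decay_constant / (real j + 1) * norm z" for j z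
    proof -
      have "((P ^^ 2) ^^ j) (P z - P (P z))
          = (P ^^ (2 * j + 1)) z - P ((P ^^ (2 * j + 1)) z)"
        by (simp add: funpow_mult contraction_linear_simps[OF contraction_funpow[OF P]] funpow_swap1)
      also have "norm \<dots> \<le> decay_constant / (real (2 * j + 1) + 1) * norm z"
        unfolding P_def by (rule Euler_power_decay[OF \<tau>2])
      also have "\<dots> \<le> decay_constant / (real j + 1) * norm z"
        using decay_constant_pos by (intro mult_right_mono divide_left_mono) auto
      finally show ?thesis .
    qed
    show "norm ((G ^^ k) x - G ((G ^^ k) x)) \<le> decay_constant / (real k + 1) * norm x" for k
      unfolding G_def by (rule Euler_power_decay[OF \<tau>])
  qed (use n decay_constant_pos in auto)
  then show ?thesis
    by (simp add: P_def G_def funpow_mult power2_eq_square)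
qed

text \<open>The errors of successive doublings decay like \<open>2\<^sup>-\<^sup>j\<^sup>/\<^sup>2\<close>, so they add up to a bound that does not
depend on the number of doublings.\<close>

lemma Euler_dyadic_refinement:
  assumes \<tau>: "0 < \<tau>" and n: "n \<ge> 1"
  shows "norm ((implicit_Euler D A (\<tau> / 2 ^ J) ^^ (n * 2 ^ J)) x - (implicit_Euler D A \<tau> ^^ n) x)
       \<le> 8 * decay_constant\<^sup>2 / sqrt (real n) * norm x"
proof -
  let ?G = "implicit_Euler D A"
  define e where "e = 2 * decay_constant\<^sup>2 / sqrt (real n) * norm x"
  have e: "0 \<le> e" by (simp add: e_def)
  have sum: "norm ((?G (\<tau> / 2 ^ J) ^^ (n * 2 ^ J)) x - (?G \<tau> ^^ n) x) \<le> e * (\<Sum>j<J. (3 / 4) ^ j)"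
  proof (induction J)
    case (Suc J)
    (* The rational ratio 3 / 4, an upper bound of 1 / sqrt 2, gives a geometric series of sum 4. *)
    have "4 / 3 \<le> sqrt 2"
      by (rule real_le_rsqrt) (simp add: power2_eq_square)
    then have "(4 / 3) ^ J \<le> sqrt 2 ^ J"
      by (intro power_mono) auto
    also have "\<dots> = sqrt (real (2 ^ J))"
      by (simp add: real_sqrt_power)
    finally have pow: "1 / sqrt (real (2 ^ J)) \<le> (3 / 4) ^ J"
      using frac_le[of 1 1 "(4 / 3) ^ J" "sqrt (real (2 ^ J))"] by (simp add: power_divide)
    have "norm ((?G (\<tau> / 2 ^ Suc J) ^^ (n * 2 ^ Suc J)) x - (?G (\<tau> / 2 ^ J) ^^ (n * 2 ^ J)) x)
        \<le> 2 * decay_constant\<^sup>2 / sqrt (real (n * 2 ^ J)) * norm x"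
      using Euler_doubling[of "\<tau> / 2 ^ J" "n * 2 ^ J" x] \<tau> n by (simp add: mult_ac)
    also have "\<dots> = e * (1 / sqrt (real (2 ^ J)))"
      by (simp add: e_def real_sqrt_mult)
    also have "\<dots> \<le> e * (3 / 4) ^ J"
      by (intro mult_left_mono pow e)
    finally have "norm ((?G (\<tau> / 2 ^ Suc J) ^^ (n * 2 ^ Suc J)) x - (?G (\<tau> / 2 ^ J) ^^ (n * 2 ^ J)) x)
        \<le> e * (3 / 4) ^ J" .
    from norm_triangle_mono[OF this Suc] show ?case
      by (simp add: algebra_simps)
  qed simp
  also have "e * (\<Sum>j<J. (3 / 4) ^ j) \<le> e * 4"
    by (intro mult_left_mono e) (simp add: sum_gp_strict)
  finally show ?thesis
    by (simp add: e_def)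
qed

end

section \<open>Implicit Euler steps and the semigroup\<close>

lemma contractions_tendsto_from_dense:
  fixes W :: "'i \<Rightarrow> 'a::complex_hilbert_space \<Rightarrow> 'a"
  assumes W: "\<forall>\<^sub>F i in Z. contraction (W i)" and V: "contraction V"
    and dense: "closure D = UNIV"
    and on_D: "\<And>d. d \<in> D \<Longrightarrow> ((\<lambda>i. W i d) \<longlongrightarrow> V d) Z"
  shows "((\<lambda>i. W i x) \<longlongrightarrow> V x) Z"
proof (rule tendstoI)
  fix e :: real assume e: "0 < e"
  then have "0 < e / 3" by simp
  then obtain d where d: "d \<in> D" "dist d x < e / 3"
    using dense by (metis UNIV_I closure_approachable)
  have "\<forall>\<^sub>F i in Z. dist (W i d) (V d) < e / 3"
    using on_D[OF d(1)] e by (intro tendstoD) auto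
  with W show "\<forall>\<^sub>F i in Z. dist (W i x) (V x) < e"
  proof eventually_elim
    case (elim i)
    have "dist (W i x) (W i d) \<le> dist x d"
      using contraction_norm[OF elim(1), of "x - d"]
      by (simp add: dist_norm contraction_linear_simps[OF elim(1)])
    moreover have "dist (V d) (V x) \<le> dist d x"
      using contraction_norm[OF V, of "d - x"]
      by (simp add: dist_norm contraction_linear_simps[OF V])
    moreover have "dist (W i x) (V x) \<le> dist (W i x) (W i d) + dist (W i d) (V d) + dist (V d) (V x)"
      by (meson add_mono dist_triangle order_refl order_trans)
    ultimately show ?case
      using elim(2) d(2) by (simp add: dist_commute)
  qed
qed

lemma contraction_id: "contraction (\<lambda>x. x)"
  by (rule contractionI) auto

context sectorial_operator
begin

lemma Euler_tendsto_id:
  assumes "closure D = UNIV"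
  shows "((\<lambda>\<tau>. implicit_Euler D A \<tau> x) \<longlongrightarrow> x) (at_right 0)"
proof (rule contractions_tendsto_from_dense[OF _ contraction_id assms])
  show "\<forall>\<^sub>F \<tau> in at_right 0. contraction (implicit_Euler D A \<tau>)"
    using eventually_at_right_less[of "0::real"]
    by eventually_elim (rule Euler_contraction)
  fix d assume d: "d \<in> D"
  have "((\<lambda>\<tau>. implicit_Euler D A \<tau> d - d) \<longlongrightarrow> 0) (at_right 0)"
  proof (rule Lim_null_comparison)
    show "\<forall>\<^sub>F \<tau> in at_right 0. norm (implicit_Euler D A \<tau> d - d) \<le> \<tau> * norm (A d)"
      using eventually_at_right_less[of "0::real"]
    proof eventually_elim
      case (elim \<tau>)
      note G = Euler_contraction[OF elim]
      have "implicit_Euler D A \<tau> (d + \<tau> *\<^sub>R A d) = d"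
        by (rule Euler_unique[OF elim d refl])
      then have "implicit_Euler D A \<tau> d - d = - (\<tau> *\<^sub>R implicit_Euler D A \<tau> (A d))"
        by (simp add: contraction_linear_simps[OF G] algebra_simps)
      then show ?case
        using elim contraction_norm[OF G, of "A d"] by simp
    qed
    show "((\<lambda>\<tau>. \<tau> * norm (A d)) \<longlongrightarrow> 0) (at_right 0)"
      by (auto intro!: tendsto_eq_intros)
  qed
  then show "((\<lambda>\<tau>. implicit_Euler D A \<tau> d) \<longlongrightarrow> d) (at_right 0)"
    by (simp add: Lim_null[symmetric])
qed

context
  fixes T :: "real \<Rightarrow> 'a \<Rightarrow> 'a"
  assumes semigroup: "contraction_C0_semigroup T"
    and generator: "generator_of T D (\<lambda>x. - A x)"
    and dense: "closure D = UNIV"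
begin

lemma semigroup_contraction: "0 \<le> t \<Longrightarrow> contraction (T t)"
  using semigroup by (simp add: contraction_C0_semigroup_def)

lemma semigroup_add: "0 \<le> s \<Longrightarrow> 0 \<le> t \<Longrightarrow> T (s + t) x = T s (T t x)"
  using semigroup by (simp add: contraction_C0_semigroup_def)

lemma semigroup_funpow:
  assumes "0 \<le> s"
  shows "(T s ^^ n) x = T (real n * s) x"
proof (induction n)
  case 0
  then show ?case
    using semigroup by (simp add: contraction_C0_semigroup_def)
next
  case (Suc n)
  then show ?case
    using semigroup_add[of s "real n * s" x] assms by (simp add: algebra_simps)
qed

text \<open>The difference quotients at \<open>T s x\<close> are the images under \<open>T s\<close> of those at \<open>x\<close>; since the domain of
the generator consists of all vectors at which the quotients converge, \<open>T s x\<close> is in it.\<close>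

lemma semigroup_preserves_dom:
  assumes "0 \<le> s" and x: "x \<in> D"
  shows "T s x \<in> D" "A (T s x) = T s (A x)"
proof -
  note Ts = semigroup_contraction[OF assms(1)]
  have "((\<lambda>h. (T h x - x) /\<^sub>R h) \<longlongrightarrow> - A x) (at_right 0)"
    using generator x by (auto simp: generator_of_def)
  then have "((\<lambda>h. T s ((T h x - x) /\<^sub>R h)) \<longlongrightarrow> T s (- A x)) (at_right 0)"
    by (rule bounded_linear.tendsto[OF contraction_bounded_linear[OF Ts]])
  moreover have "\<forall>\<^sub>F h in at_right 0. T s ((T h x - x) /\<^sub>R h) = (T h (T s x) - T s x) /\<^sub>R h"
    using eventually_at_right_less[of "0::real"]
  proof eventually_elim
    case (elim h)
    then show ?case
      using semigroup_add[of s h x] semigroup_add[of h s x] assms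
      by (simp add: contraction_linear_simps[OF Ts] add.commute)
  qed
  ultimately have "((\<lambda>h. (T h (T s x) - T s x) /\<^sub>R h) \<longlongrightarrow> T s (- A x)) (at_right 0)"
    by (rule Lim_transform_eventually)
  then have "T s x \<in> D \<and> T s (- A x) = - A (T s x)"
    using generator by (simp add: generator_of_def)
  then show "T s x \<in> D" "A (T s x) = T s (A x)"
    by (auto simp: contraction_linear_simps[OF Ts])
qed

lemma Euler_semigroup_commute:
  assumes "0 < \<tau>" "0 \<le> s"
  shows "implicit_Euler D A \<tau> (T s x) = T s (implicit_Euler D A \<tau> x)"
proof (rule Euler_unique[OF assms(1)])
  let ?g = "implicit_Euler D A \<tau> x"
  note Ts = semigroup_contraction[OF assms(2)]
  have g: "?g \<in> D" "?g + \<tau> *\<^sub>R A ?g = x"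
    by (rule Euler_eq[OF assms(1)])+
  show "T s ?g \<in> D"
    by (rule semigroup_preserves_dom(1)[OF assms(2) g(1)])
  have "T s ?g + \<tau> *\<^sub>R A (T s ?g) = T s (?g + \<tau> *\<^sub>R A ?g)"
    by (simp add: semigroup_preserves_dom(2)[OF assms(2) g(1)] contraction_linear_simps[OF Ts])
  then show "T s ?g + \<tau> *\<^sub>R A (T s ?g) = T s x"
    unfolding g(2) .
qed

text \<open>Both \<open>(G - 1) / \<tau>\<close> and \<open>(T \<tau> - 1) / \<tau>\<close> tend to \<open>- A d\<close> on the domain, the former because
\<open>G d - d = - \<tau> G (A d)\<close>.\<close>

lemma Euler_consistency:
  assumes d: "d \<in> D"
  shows "((\<lambda>\<tau>. (implicit_Euler D A \<tau> d - T \<tau> d) /\<^sub>R \<tau>) \<longlongrightarrow> 0) (at_right 0)"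
proof -
  have "((\<lambda>\<tau>. (T \<tau> d - d) /\<^sub>R \<tau>) \<longlongrightarrow> - A d) (at_right 0)"
    using generator d by (auto simp: generator_of_def)
  from tendsto_diff[OF tendsto_minus[OF Euler_tendsto_id[OF dense, of "A d"]] this]
  have lim: "((\<lambda>\<tau>. - implicit_Euler D A \<tau> (A d) - (T \<tau> d - d) /\<^sub>R \<tau>) \<longlongrightarrow> 0) (at_right 0)"
    by simp
  have "\<forall>\<^sub>F \<tau> in at_right 0. - implicit_Euler D A \<tau> (A d) - (T \<tau> d - d) /\<^sub>R \<tau>
      = (implicit_Euler D A \<tau> d - T \<tau> d) /\<^sub>R \<tau>"
    using eventually_at_right_less[of "0::real"]
  proof eventually_elim
    case (elim \<tau>)
    note G = Euler_contraction[OF elim]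
    have "implicit_Euler D A \<tau> (d + \<tau> *\<^sub>R A d) = d"
      by (rule Euler_unique[OF elim d refl])
    then have eq: "implicit_Euler D A \<tau> d = d - \<tau> *\<^sub>R implicit_Euler D A \<tau> (A d)"
      by (simp add: contraction_linear_simps[OF G] algebra_simps)
    show ?case
      unfolding eq using elim by (simp add: algebra_simps)
  qed
  with lim show ?thesis
    by (rule Lim_transform_eventually)
qed

text \<open>On the domain this is stability plus consistency: the Euler steps and the semigroup commute and are
contractions, so each of the \<open>m\<close> terms of the telescoping sum is at most the one-step error at the
fixed vector \<open>d\<close>, which is \<open>o(1 / m)\<close>. There is no rate here; the rate comes from
\<open>Euler_dyadic_refinement\<close>.\<close>

lemma Euler_power_tendsto_semigroup:
  assumes t: "0 < t"
  shows "((\<lambda>m. (implicit_Euler D A (t / real m) ^^ m) x) \<longlonglongrightarrow> T t x)"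
proof (rule contractions_tendsto_from_dense[OF _ semigroup_contraction dense])
  let ?G = "implicit_Euler D A"
  show "\<forall>\<^sub>F m in sequentially. contraction (?G (t / real m) ^^ m)"
    using eventually_gt_at_top[of "0::nat"]
    by eventually_elim (use t in \<open>auto intro!: contraction_funpow Euler_contraction\<close>)
  fix d assume d: "d \<in> D"
  have step: "filterlim (\<lambda>m. t / real m) (at_right 0) sequentially"
    unfolding filterlim_at
    using t by (auto intro!: real_tendsto_divide_at_top filterlim_real_sequentially
        eventually_mono[OF eventually_gt_at_top[of "0::nat"]])
  have "((\<lambda>m. (?G (t / real m) ^^ m) d - T t d) \<longlonglongrightarrow> 0)"
  proof (rule Lim_null_comparison)
    show "\<forall>\<^sub>F m in sequentially. norm ((?G (t / real m) ^^ m) d - T t d)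
        \<le> t * norm ((?G (t / real m) d - T (t / real m) d) /\<^sub>R (t / real m))"
      using eventually_gt_at_top[of "0::nat"]
    proof eventually_elim
      case (elim m)
      define \<tau> where "\<tau> = t / real m"
      have \<tau>: "0 < \<tau>" "real m * \<tau> = t"
        using elim t by (auto simp: \<tau>_def)
      note G = Euler_contraction[OF \<tau>(1)]
      have "norm ((?G \<tau> ^^ m) d - (T \<tau> ^^ m) d)
          \<le> (\<Sum>k<m. norm ((?G \<tau> ^^ (m - 1 - k)) (?G \<tau> ((T \<tau> ^^ k) d) - T \<tau> ((T \<tau> ^^ k) d))))"
        unfolding funpow_difference_telescope[OF bounded_linear.linear[OF contraction_bounded_linear[OF G]]]
        by (rule norm_sum)
      also have "\<dots> \<le> (\<Sum>k<m. norm (?G \<tau> d - T \<tau> d))"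
      proof (rule sum_mono)
        fix k assume "k \<in> {..<m}"
        have nonneg: "0 \<le> real k * \<tau>" using \<tau> by simp
        note Tk = semigroup_contraction[OF nonneg]
        have "?G \<tau> ((T \<tau> ^^ k) d) - T \<tau> ((T \<tau> ^^ k) d) = T (real k * \<tau>) (?G \<tau> d - T \<tau> d)"
          using \<tau> nonneg semigroup_add[of "real k * \<tau>" \<tau> d] semigroup_add[of \<tau> "real k * \<tau>" d]
          by (simp add: semigroup_funpow Euler_semigroup_commute contraction_linear_simps[OF Tk] add.commute)
        then show "norm ((?G \<tau> ^^ (m - 1 - k)) (?G \<tau> ((T \<tau> ^^ k) d) - T \<tau> ((T \<tau> ^^ k) d)))
            \<le> norm (?G \<tau> d - T \<tau> d)"
          using contraction_norm[OF contraction_funpow[OF G]] contraction_norm[OF Tk]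
          by (metis order_trans)
      qed
      also have "\<dots> = t * norm ((?G \<tau> d - T \<tau> d) /\<^sub>R \<tau>)"
        unfolding \<tau>(2)[symmetric] using \<tau>(1) by simp
      finally show ?case
        using \<tau> by (simp add: semigroup_funpow \<tau>_def[symmetric])
    qed
    have "((\<lambda>m. (?G (t / real m) d - T (t / real m) d) /\<^sub>R (t / real m)) \<longlonglongrightarrow> 0)"
      by (rule filterlim_compose[OF Euler_consistency[OF d] step])
    from tendsto_mult_left[OF tendsto_norm[OF this], of t]
    show "((\<lambda>m. t * norm ((?G (t / real m) d - T (t / real m) d) /\<^sub>R (t / real m))) \<longlonglongrightarrow> 0)"
      by simp
  qed
  then show "((\<lambda>m. (?G (t / real m) ^^ m) d) \<longlonglongrightarrow> T t d)"
    by (simp add: Lim_null[symmetric])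
qed (use t in simp)

text \<open>Let the number of doublings in \<open>Euler_dyadic_refinement\<close> tend to infinity.\<close>

lemma Euler_semigroup_error:
  assumes t: "0 < t" and n: "n \<ge> 1"
  shows "norm ((implicit_Euler D A (t / real n) ^^ n) x - T t x)
       \<le> 8 * decay_constant\<^sup>2 / sqrt (real n) * norm x"
proof -
  let ?G = "implicit_Euler D A"
  have sub: "filterlim (\<lambda>J. n * 2 ^ J :: nat) sequentially sequentially"
    by (rule filterlim_subseq) (use n in \<open>auto intro!: strict_monoI_Suc\<close>)
  have "(\<lambda>J. (?G (t / real (n * 2 ^ J)) ^^ (n * 2 ^ J)) x - (?G (t / real n) ^^ n) x)
      \<longlonglongrightarrow> T t x - (?G (t / real n) ^^ n) x"
    by (intro tendsto_diff tendsto_const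
        filterlim_compose[OF Euler_power_tendsto_semigroup[OF t] sub])
  then have "norm (T t x - (?G (t / real n) ^^ n) x) \<le> 8 * decay_constant\<^sup>2 / sqrt (real n) * norm x"
  proof (rule Lim_norm_ubound[OF trivial_limit_sequentially], intro always_eventually allI)
    fix J
    show "norm ((?G (t / real (n * 2 ^ J)) ^^ (n * 2 ^ J)) x - (?G (t / real n) ^^ n) x)
        \<le> 8 * decay_constant\<^sup>2 / sqrt (real n) * norm x"
      using Euler_dyadic_refinement[of "t / real n" n J x] t n by simp
  qed
  then show ?thesis
    by (simp add: norm_minus_commute)
qed

end

end

section \<open>Implicit Euler steps of two operators\<close>

text \<open>The factorisation is formally
\<open>B - G = \<tau> B (A2 - A1) G\<close> and \<open>Q - R = Q (A2 - A1) R\<close> for the resolvents \<open>Q\<close>, \<open>R\<close> at \<open>z\<close>, thus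
\<open>B - G = \<tau> B (z + A1) (Q - R) (z + A2) G\<close>. Here \<open>\<tau> (z + A1) B = \<tau> z B + (1 - B)\<close>, and similarly for
\<open>G\<close>. The summands \<open>1 - B\<close> and \<open>1 - G\<close> are smoothed by the powers. The choice \<open>z = 1 / (n \<tau>)\<close>, the
inverse of the total time, makes the other summand \<open>B / n\<close>, which is as small as a smoothed term.
At \<open>z = 1 / \<tau>\<close> the difference of the resolvents would be \<open>\<tau> (B - G)\<close> itself, without any smoothing factor.\<close>

lemma Euler_powers_difference:
  assumes A1: "sectorial_operator D1 A1 c" and A2: "sectorial_operator D2 A2 c"
    and \<tau>: "0 < \<tau>" and n: "n \<ge> 1" and \<delta>: "0 \<le> \<delta>"
    and resolvents: "\<And>y. norm (shifted_inverse D1 A1 (complex_of_real (1 / (real n * \<tau>))) y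
          - shifted_inverse D2 A2 (complex_of_real (1 / (real n * \<tau>))) y) \<le> \<delta> * norm y"
  shows "norm ((implicit_Euler D1 A1 \<tau> ^^ n) x - (implicit_Euler D2 A2 \<tau> ^^ n) x)
       \<le> 4 * (1 + sectorial_operator.decay_constant c)\<^sup>2 * (\<delta> / \<tau>) / sqrt (real n) * norm x"
proof -
  interpret A1: sectorial_operator D1 A1 c by (rule A1)
  interpret A2: sectorial_operator D2 A2 c by (rule A2)
  define C where "C = sectorial_operator.decay_constant c"
  define B where "B = implicit_Euler D1 A1 \<tau>"
  define G where "G = implicit_Euler D2 A2 \<tau>"
  define z where "z = 1 / (real n * \<tau>)"
  define Q where "Q = shifted_inverse D1 A1 (complex_of_real z)"
  define R where "R = shifted_inverse D2 A2 (complex_of_real z)"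
  have z: "0 < z" "\<tau> * z = 1 / real n"
    using \<tau> n by (auto simp: z_def)
  have C: "0 < C"
    unfolding C_def by (rule A1.decay_constant_pos)
  have B: "contraction B" and G: "contraction G"
    unfolding B_def G_def by (rule A1.Euler_contraction[OF \<tau>] A2.Euler_contraction[OF \<tau>])+
  note B_lin = contraction_linear_simps[OF B] and G_lin = contraction_linear_simps[OF G]
  define X where "X w = (1 / real n) *\<^sub>R B w + (w - B w)" for w
  define Y where "Y w = (1 / real n) *\<^sub>R G w + (w - G w)" for w
  define E where "E w = (1 / \<tau>) *\<^sub>R (Q w - R w)" for w
  have decay: "norm ((1 / real n) *\<^sub>R v + (u - v)) \<le> (1 + C) / (real j + 1) * norm w"
    if j: "j < n" and v: "norm v \<le> norm w" and uv: "norm (u - v) \<le> C / (real j + 1) * norm w"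
    for j u v and w :: 'a
  proof -
    have "norm ((1 / real n) *\<^sub>R v) \<le> 1 / (real j + 1) * norm w"
      unfolding norm_scaleR using j v by (intro mult_mono) (auto simp: field_simps)
    with uv show ?thesis
      using norm_triangle_ineq[of "(1 / real n) *\<^sub>R v" "u - v"]
      by (simp add: add_divide_distrib distrib_right)
  qed
  have factor: "B x - G x = X (E (Y x))" for x
  proof -
    define g where "g = G x"
    define p where "p = (1 / \<tau>) *\<^sub>R Y x"
    define q where "q = Q p"
    have g: "g \<in> D2" "g + \<tau> *\<^sub>R A2 g = x"
      using A2.Euler_eq[OF \<tau>, of x] by (auto simp: g_def G_def)
    have q: "q \<in> D1" "z *\<^sub>R q + A1 q = p"
      using A1.resolvent_eq[OF z(1), of p] by (auto simp: q_def Q_def)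
    have Yx: "Y x = \<tau> *\<^sub>R p"
      using \<tau> by (simp add: p_def)
    have "\<tau> *\<^sub>R (z *\<^sub>R g + A2 g) = Y x"
      unfolding Y_def g_def[symmetric] using g(2) z(2)
      by (simp add: scaleR_add_right eq_diff_eq add.commute)
    then have "z *\<^sub>R g + A2 g = p"
      using \<tau> by (simp add: p_def flip: \<open>\<tau> *\<^sub>R (z *\<^sub>R g + A2 g) = Y x\<close>)
    then have Rp: "R p = g"
      unfolding R_def by (rule A2.resolvent_unique[OF z(1) g(1)])
    have Q_lin: "Q (\<tau> *\<^sub>R p) = \<tau> *\<^sub>R q"
    proof -
      have "z *\<^sub>R (\<tau> *\<^sub>R q) + A1 (\<tau> *\<^sub>R q) = \<tau> *\<^sub>R (z *\<^sub>R q + A1 q)"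
        by (simp add: A1.op_scaleR[OF q(1)] scaleR_add_right mult.commute)
      then show ?thesis
        unfolding Q_def q(2) using A1.dom_scaleC[OF q(1), of "complex_of_real \<tau>"]
        by (intro A1.resolvent_unique[OF z(1)]) (auto simp: scaleR_scaleC)
    qed
    have R_lin: "R (\<tau> *\<^sub>R p) = \<tau> *\<^sub>R g"
    proof -
      have "z *\<^sub>R (\<tau> *\<^sub>R g) + A2 (\<tau> *\<^sub>R g) = \<tau> *\<^sub>R (z *\<^sub>R g + A2 g)"
        by (simp add: A2.op_scaleR[OF g(1)] scaleR_add_right mult.commute)
      then show ?thesis
        unfolding R_def \<open>z *\<^sub>R g + A2 g = p\<close> using A2.dom_scaleC[OF g(1), of "complex_of_real \<tau>"]
        by (intro A2.resolvent_unique[OF z(1)]) (auto simp: scaleR_scaleC)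
    qed
    have EY: "E (Y x) = q - g"
      unfolding E_def Yx Q_lin R_lin using \<tau> by (simp flip: scaleR_diff_right)
    have "q + \<tau> *\<^sub>R A1 q = q + (\<tau> *\<^sub>R p - (1 / real n) *\<^sub>R q)"
      unfolding q(2)[symmetric] z(2)[symmetric] by (simp add: scaleR_add_right)
    then have "B (q + (\<tau> *\<^sub>R p - (1 / real n) *\<^sub>R q)) = q"
      unfolding B_def by (intro A1.Euler_unique[OF \<tau> q(1)])
    then have B\<tau>p: "\<tau> *\<^sub>R B p = q - B q + (1 / real n) *\<^sub>R B q"
      by (simp add: B_lin algebra_simps)
    have x: "x = g + (\<tau> *\<^sub>R p - (1 / real n) *\<^sub>R g)"
      unfolding Yx[symmetric] Y_def g_def by simp
    have "B x - g = B g + (\<tau> *\<^sub>R B p - (1 / real n) *\<^sub>R B g) - g"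
      by (subst x) (simp add: B_lin)
    also have "\<dots> = X (q - g)"
      unfolding B\<tau>p X_def by (simp add: B_lin algebra_simps)
    finally show ?thesis
      unfolding EY g_def .
  qed
  have "norm ((B ^^ n) x - (G ^^ n) x)
      \<le> 4 * ((1 + C) * (\<delta> / \<tau>) * (1 + C)) / sqrt (real n) * norm x"
  proof (rule funpow_difference_le[where X = X and Y = Y and E = E])
    show "linear B"
      by (intro bounded_linear.linear contraction_bounded_linear B)
    show "norm ((B ^^ j) (X w)) \<le> (1 + C) / (real j + 1) * norm w" if "j < n" for j w
    proof -
      note Bj = contraction_linear_simps[OF contraction_funpow[OF B, of j]]
      have "(B ^^ j) (X w) = (1 / real n) *\<^sub>R B ((B ^^ j) w) + ((B ^^ j) w - B ((B ^^ j) w))"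
        unfolding X_def Bj by (simp only: funpow_swap1)
      moreover have "norm (B ((B ^^ j) w)) \<le> norm w"
        by (rule order_trans[OF contraction_norm[OF B] contraction_norm[OF contraction_funpow[OF B]]])
      moreover have "norm ((B ^^ j) w - B ((B ^^ j) w)) \<le> C / (real j + 1) * norm w"
        unfolding B_def C_def by (rule A1.Euler_power_decay[OF \<tau>])
      ultimately show ?thesis
        using decay[OF that] by simp
    qed
    show "norm (E w) \<le> \<delta> / \<tau> * norm w" for w
    proof -
      have "norm (E w) = norm (Q w - R w) / \<tau>"
        using \<tau> by (simp add: E_def)
      also have "\<dots> \<le> \<delta> * norm w / \<tau>"
        unfolding Q_def R_def z_def using \<tau> by (intro divide_right_mono resolvents) auto
      finally show ?thesis by simp
    qed
    show "norm (Y ((G ^^ k) x)) \<le> (1 + C) / (real k + 1) * norm x" if "k < n" for k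
    proof -
      have "norm (G ((G ^^ k) x)) \<le> norm x"
        by (rule order_trans[OF contraction_norm[OF G] contraction_norm[OF contraction_funpow[OF G]]])
      moreover have "norm ((G ^^ k) x - G ((G ^^ k) x)) \<le> C / (real k + 1) * norm x"
        unfolding G_def C_def by (rule A2.Euler_power_decay[OF \<tau>])
      ultimately show ?thesis
        unfolding Y_def by (rule decay[OF that])
    qed
  qed (use n \<delta> \<tau> C factor in auto)
  then show ?thesis
    by (simp add: B_def G_def C_def power2_eq_square mult_ac)
qed

section \<open>Quasi-sectorial contractions\<close>

lemma Re_ge_of_Arg_le:
  assumes "\<bar>Arg w\<bar> \<le> \<alpha>" "\<alpha> \<le> pi"
  shows "cos \<alpha> * cmod w \<le> Re w"
proof -
  have "cos \<alpha> \<le> cos \<bar>Arg w\<bar>"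
    using assms by (intro cos_monotone_0_pi_le) auto
  then have "cos \<alpha> * cmod w \<le> cmod w * cos (Arg w)"
    using mult_right_mono[of "cos \<alpha>" "cos (Arg w)" "cmod w"] by (simp add: mult.commute)
  also have "\<dots> = Re (rcis (cmod w) (Arg w))"
    by simp
  also have "\<dots> = Re w"
    by (simp only: rcis_cmod_Arg)
  finally show ?thesis .
qed

lemma sector_Re_ge:
  assumes "w \<in> sector \<alpha>" "0 \<le> \<alpha>" "\<alpha> \<le> pi"
  shows "cos \<alpha> * cmod w \<le> Re w"
  using assms by (intro Re_ge_of_Arg_le) (auto simp: sector_def)

context
  fixes \<alpha> :: real
  assumes \<alpha>: "0 \<le> \<alpha>" "\<alpha> < pi / 2"
begin

lemma cos_angle_pos: "0 < cos \<alpha>"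
  using \<alpha> by (intro cos_gt_zero_pi) auto

lemma sin_angle_less_1: "sin \<alpha> < 1"
  using \<alpha> sin_monotone_2pi[of \<alpha> "pi / 2"] by simp

text \<open>The tangents from \<open>1\<close> to the disc of radius \<open>sin \<alpha>\<close> enclose the angle \<open>2 \<alpha>\<close>, so the disc lies in
the sector with vertex \<open>1\<close>. In formulas this is \<open>(\<bar>1 - z\<bar> - cos \<alpha>)\<^sup>2 \<ge> 0\<close>.\<close>

lemma D_dom_Re_ge:
  assumes "z \<in> D_dom \<alpha>"
  shows "cos \<alpha> * cmod (1 - z) \<le> Re (1 - z)"
proof (cases "cmod z \<le> sin \<alpha>")
  case True
  then have "(cmod z)\<^sup>2 \<le> (sin \<alpha>)\<^sup>2"
    by (intro power_mono) auto
  moreover have "(cmod z)\<^sup>2 = 1 - 2 * Re (1 - z) + (cmod (1 - z))\<^sup>2"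
    by (simp add: cmod_power2) (simp add: power2_eq_square algebra_simps)
  moreover have "0 \<le> (cmod (1 - z) - cos \<alpha>)\<^sup>2"
    by simp
  ultimately show ?thesis
    by (simp add: power2_diff sin_squared_eq mult_ac)
next
  case False
  then show ?thesis
    using assms \<alpha> by (intro Re_ge_of_Arg_le) (auto simp: D_dom_def)
qed

text \<open>The domain touches the unit circle only at \<open>1\<close>, and there within a sector of angle less than \<open>\<pi>\<close>.
Close to \<open>1\<close>, with \<open>w = 1 - z\<close>, the radius \<open>cos \<alpha>\<close> of the circular sector gives
\<open>\<bar>w\<bar>\<^sup>2 \<le> cos \<alpha> \<bar>w\<bar> \<le> Re w\<close>, hence \<open>\<bar>z\<bar>\<^sup>2 = 1 - 2 Re w + \<bar>w\<bar>\<^sup>2 \<le> 1 - Re w\<close>: the gap \<open>1 - \<bar>z\<bar>\<close>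
is at least a multiple of \<open>\<bar>1 - z\<bar>\<close>.\<close>

lemma D_dom_dist_unit_circle:
  assumes z: "z \<in> D_dom \<alpha>" and \<mu>: "cmod \<mu> = 1"
  shows "cmod (\<mu> - 1) \<le> (1 + 2 / (1 - sin \<alpha>) + 2 / cos \<alpha>) * cmod (\<mu> - z)"
proof -
  let ?p = "1 + 2 / (1 - sin \<alpha>) + 2 / cos \<alpha>"
  have gap: "1 - cmod z \<le> cmod (\<mu> - z)"
    using norm_triangle_ineq2[of \<mu> z] \<mu> by simp
  show ?thesis
  proof (cases "cmod z \<le> sin \<alpha>")
    case True
    have "cmod (\<mu> - 1) \<le> 2"
      using norm_triangle_ineq4[of \<mu> 1] \<mu> by simp
    also have "2 = 2 / (1 - sin \<alpha>) * (1 - sin \<alpha>)"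
      using sin_angle_less_1 by (simp add: field_simps)
    also have "\<dots> \<le> 2 / (1 - sin \<alpha>) * cmod (\<mu> - z)"
      using sin_angle_less_1 gap True by (intro mult_left_mono) auto
    also have "\<dots> \<le> ?p * cmod (\<mu> - z)"
      using cos_angle_pos by (intro mult_right_mono) auto
    finally show ?thesis .
  next
    case False
    then have "cmod (1 - z) \<le> cos \<alpha>"
      using z by (auto simp: D_dom_def norm_minus_commute)
    then have "(cmod (1 - z))\<^sup>2 \<le> cos \<alpha> * cmod (1 - z)"
      unfolding power2_eq_square by (intro mult_right_mono) auto
    also have D: "\<dots> \<le> Re (1 - z)"
      by (rule D_dom_Re_ge[OF z])
    finally have "(cmod z)\<^sup>2 \<le> 1 - Re (1 - z)"
      by (simp add: cmod_power2) (simp add: power2_eq_square algebra_simps)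
    moreover have "2 * cmod z \<le> 1 + (cmod z)\<^sup>2"
      using zero_le_power2[of "cmod z - 1"] by (simp add: power2_diff)
    ultimately have "cos \<alpha> * cmod (1 - z) \<le> 2 * cmod (\<mu> - z)"
      using D gap by linarith
    then have "cmod (1 - z) \<le> 2 / cos \<alpha> * cmod (\<mu> - z)"
      using cos_angle_pos by (simp add: field_simps)
    then have "cmod (\<mu> - 1) \<le> (1 + 2 / cos \<alpha>) * cmod (\<mu> - z)"
      using norm_triangle_ineq[of "\<mu> - z" "z - 1"]
      by (simp add: norm_minus_commute algebra_simps)
    also have "\<dots> \<le> ?p * cmod (\<mu> - z)"
      using sin_angle_less_1 by (intro mult_right_mono) auto
    finally show ?thesis .
  qed
qed

lemma quasi_sectorial_power_decay:
  fixes F :: "'a::complex_hilbert_space \<Rightarrow> 'a"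
  assumes F: "contraction F" and W: "numerical_range UNIV F \<subseteq> D_dom \<alpha>"
  shows "norm ((F ^^ n) x - F ((F ^^ n) x))
       \<le> 6 * (2 + 2 / (1 - sin \<alpha>) + 2 / cos \<alpha>) / (real n + 1) * norm x"
proof (rule Ritt_resolvent_imp_power_decay[OF F])
  let ?p = "1 + 2 / (1 - sin \<alpha>) + 2 / cos \<alpha>"
  show "1 \<le> 2 + 2 / (1 - sin \<alpha>) + 2 / cos \<alpha>"
    using cos_angle_pos sin_angle_less_1 by (simp add: add_nonneg_nonneg)
  show "norm (x - F x) \<le> (2 + 2 / (1 - sin \<alpha>) + 2 / cos \<alpha>) * norm (\<mu> *\<^sub>C x - F x)"
    if \<mu>: "cmod \<mu> = 1" for \<mu> x
  proof -
    have "cmod (\<mu> - 1) * norm x \<le> ?p * norm (\<mu> *\<^sub>C x - F x)"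
    proof (cases "x = 0")
      case False
      define e where "e = x /\<^sub>R norm x"
      have e: "norm e = 1" "x = norm x *\<^sub>R e"
        using False by (auto simp: e_def)
      have "cinner e (F e) \<in> D_dom \<alpha>"
        using W e(1) by (auto simp: numerical_range_def)
      then have "cmod (\<mu> - 1) \<le> ?p * cmod (\<mu> - cinner e (F e))"
        by (rule D_dom_dist_unit_circle[OF _ \<mu>])
      also have "\<mu> - cinner e (F e) = cinner e (\<mu> *\<^sub>C e - F e)"
        by (simp add: cinner_diff_right cinner_scaleC_right cinner_self e(1))
      also have "?p * cmod (cinner e (\<mu> *\<^sub>C e - F e)) \<le> ?p * norm (\<mu> *\<^sub>C e - F e)"
        using cinner_Cauchy_Schwarz[of e "\<mu> *\<^sub>C e - F e"] e(1) cos_angle_pos sin_angle_less_1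
        by (intro mult_left_mono) (auto intro!: add_nonneg_nonneg)
      finally have "norm x * cmod (\<mu> - 1) \<le> norm x * (?p * norm (\<mu> *\<^sub>C e - F e))"
        by (intro mult_left_mono) auto
      also have "\<dots> = ?p * norm (norm x *\<^sub>R (\<mu> *\<^sub>C e - F e))"
        by simp
      also have "norm x *\<^sub>R (\<mu> *\<^sub>C e - F e) = \<mu> *\<^sub>C (norm x *\<^sub>R e) - F (norm x *\<^sub>R e)"
        by (simp add: scaleR_diff_right scaleC_scaleR_commute contraction_linear_simps[OF F])
      also have "\<dots> = \<mu> *\<^sub>C x - F x"
        by (simp only: e(2)[symmetric])
      finally show ?thesis
        by (simp add: mult.commute)
    qed (simp add: contraction_linear_simps[OF F])
    moreover have "norm (x - F x) \<le> norm (\<mu> *\<^sub>C x - F x) + cmod (\<mu> - 1) * norm x"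
      using norm_triangle_ineq4[of "\<mu> *\<^sub>C x - F x" "(\<mu> - 1) *\<^sub>C x"]
      by (simp add: norm_scaleC[symmetric] scaleC_diff_left)
    ultimately show ?thesis
      by (simp add: algebra_simps)
  qed
qed

end

section \<open>Resolvents of m-sectorial operators\<close>

lemma form_of_numerical_range:
  assumes lin: "linear_operator D A"
    and W: "\<And>w. w \<in> numerical_range D A \<Longrightarrow> k * cmod w \<le> Re w"
    and x: "x \<in> D"
  shows "k * cmod (cinner x (A x)) \<le> Re (cinner x (A x))"
proof (cases "x = 0")
  case False
  define e where "e = complex_of_real (inverse (norm x)) *\<^sub>C x"
  have e: "e \<in> D" "A e = complex_of_real (inverse (norm x)) *\<^sub>C A x" "norm e = 1"
    using lin x False by (auto simp: e_def linear_operator_def norm_scaleC simp del: of_real_inverse)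
  have eq: "cinner x (A x) = complex_of_real ((norm x)\<^sup>2) * cinner e (A e)"
    unfolding e(2) using False
    by (simp add: e_def cinner_scaleC_left cinner_scaleC_right power2_eq_square field_simps)
  have "k * cmod (cinner e (A e)) \<le> Re (cinner e (A e))"
    using e(1,3) by (intro W) (auto simp: numerical_range_def)
  then have "(norm x)\<^sup>2 * (k * cmod (cinner e (A e))) \<le> (norm x)\<^sup>2 * Re (cinner e (A e))"
    by (intro mult_left_mono) auto
  then show ?thesis
    unfolding eq by (simp add: norm_mult mult_ac norm_power flip: of_real_power)
qed simp

lemma quasi_m_accretive_linear:
  assumes "quasi_m_accretive D A"
  shows "linear_operator D A"
proof -
  obtain k :: real where "linear_operator D (\<lambda>x. A x + k *\<^sub>R x)"
    using assms by (auto simp: quasi_m_accretive_def m_accretive_def)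
  then show ?thesis
    by (auto simp: linear_operator_def scaleC_add_right scaleC_scaleR_commute algebra_simps)
qed

lemma quasi_m_accretive_dense: "quasi_m_accretive D A \<Longrightarrow> closure D = UNIV"
  by (auto simp: quasi_m_accretive_def m_accretive_def)

text \<open>Quasi-m-accretivity gives an inverse of \<open>m + A\<close> only for large \<open>m\<close>, but accretivity bounds it by
\<open>1 / m\<close>. Therefore \<open>x \<mapsto> (m + A)\<^sup>-\<^sup>1 (y + (m - z) x)\<close> is a strict contraction as soon as
\<open>0 < z < m\<close>, and its fixed point solves \<open>(z + A) x = y\<close>.\<close>

lemma quasi_m_accretive_onto:
  fixes A :: "'a::complex_hilbert_space \<Rightarrow> 'a"
  assumes A: "quasi_m_accretive D A"
    and accretive: "\<And>x. x \<in> D \<Longrightarrow> 0 \<le> Re (cinner x (A x))"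
    and z: "0 < z"
  shows "\<exists>x\<in>D. z *\<^sub>R x + A x = y"
proof -
  obtain k :: real where k: "m_accretive D (\<lambda>x. A x + k *\<^sub>R x)"
    using A by (auto simp: quasi_m_accretive_def)
  define m where "m = max z k + 1"
  have m: "z < m" "k < m" "0 < m"
    using z by (auto simp: m_def)
  have lin: "linear_operator D A"
    by (rule quasi_m_accretive_linear[OF A])
  have "bij_betw (\<lambda>x. complex_of_real (m - k) *\<^sub>C x + (A x + k *\<^sub>R x)) D UNIV"
    using k m by (auto simp: m_accretive_def)
  moreover have "complex_of_real (m - k) *\<^sub>C x + (A x + k *\<^sub>R x) = m *\<^sub>R x + A x" for x
    unfolding scaleR_scaleC[symmetric] by (simp add: scaleR_diff_left)
  ultimately have surj: "(\<lambda>x. m *\<^sub>R x + A x) ` D = UNIV"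
    by (simp only: bij_betw_def)
  have "\<exists>x\<in>D. m *\<^sub>R x + A x = u" for u
  proof -
    have "u \<in> (\<lambda>x. m *\<^sub>R x + A x) ` D"
      by (simp only: surj UNIV_I)
    then show ?thesis
      by blast
  qed
  then obtain R where R: "\<And>u. R u \<in> D" "\<And>u. m *\<^sub>R R u + A (R u) = u"
    by metis
  have R_Lipschitz: "norm (R u - R v) \<le> norm (u - v) / m" for u v
  proof (cases "R u = R v")
    case False
    define w where "w = R u + (-1) *\<^sub>C R v"
    have w: "w \<in> D" "A w = A (R u) + (-1) *\<^sub>C A (R v)"
      using lin R(1)[of u] R(1)[of v] by (simp_all add: w_def linear_operator_def)
    have w_eq: "w = R u - R v"
      by (simp add: w_def scaleC_minus_left)
    have "m *\<^sub>R w + A w = (m *\<^sub>R R u + A (R u)) - (m *\<^sub>R R v + A (R v))"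
      unfolding w(2) by (simp add: w_eq scaleC_minus_left scaleR_diff_right)
    then have uv: "m *\<^sub>R w + A w = u - v"
      by (simp only: R(2))
    have "m * (norm w)\<^sup>2 \<le> Re (cinner w (m *\<^sub>R w + A w))"
      using accretive[OF w(1)]
      by (simp add: cinner_add_right cinner_scaleR_right cinner_self flip: of_real_power)
    also have "\<dots> \<le> norm w * norm (u - v)"
      unfolding uv by (rule order_trans[OF complex_Re_le_cmod cinner_Cauchy_Schwarz])
    finally have "norm w * (m * norm w) \<le> norm w * norm (u - v)"
      by (simp add: power2_eq_square mult_ac)
    then show ?thesis
      using False m by (simp add: w_eq field_simps)
  qed (use m in simp)
  have "\<exists>!x. R (y + (m - z) *\<^sub>R x) = x"
  proof (rule banach_fix_type)
    show "0 \<le> (m - z) / m" "(m - z) / m < 1"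
      using m z by auto
    show "\<forall>x x'. dist (R (y + (m - z) *\<^sub>R x)) (R (y + (m - z) *\<^sub>R x')) \<le> (m - z) / m * dist x x'"
    proof (intro allI)
      fix x x'
      have "norm (y + (m - z) *\<^sub>R x - (y + (m - z) *\<^sub>R x')) = (m - z) * norm (x - x')"
        using m by (simp flip: scaleR_diff_right)
      then show "dist (R (y + (m - z) *\<^sub>R x)) (R (y + (m - z) *\<^sub>R x')) \<le> (m - z) / m * dist x x'"
        using R_Lipschitz[of "y + (m - z) *\<^sub>R x" "y + (m - z) *\<^sub>R x'"] by (simp add: dist_norm)
    qed
  qed
  then obtain x where x: "R (y + (m - z) *\<^sub>R x) = x"
    by blast
  have "m *\<^sub>R x + A x = y + (m - z) *\<^sub>R x"
    using R(2)[of "y + (m - z) *\<^sub>R x"] by (simp only: x)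
  then have "z *\<^sub>R x + A x = y"
    by (simp add: algebra_simps)
  then show ?thesis
    using R(1)[of "y + (m - z) *\<^sub>R x"] by (auto simp: x)
qed

lemma sectorial_operatorI:
  assumes A: "quasi_m_accretive D A" and c: "0 < c"
    and W: "\<And>w. w \<in> numerical_range D A \<Longrightarrow> c * cmod w \<le> Re w"
  shows "sectorial_operator D A c"
proof
  show lin: "linear_operator D A"
    by (rule quasi_m_accretive_linear[OF A])
  show form: "c * cmod (cinner x (A x)) \<le> Re (cinner x (A x))" if "x \<in> D" for x
    by (rule form_of_numerical_range[OF lin W that])
  have "0 \<le> Re (cinner x (A x))" if "x \<in> D" for x
    by (rule order_trans[OF _ form[OF that]]) (use c in simp)
  then show "\<exists>x\<in>D. z *\<^sub>R x + A x = y" if "0 < z" for z y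
    by (rule quasi_m_accretive_onto[OF A _ that])
qed (rule c)

lemma (in sectorial_operator) resolvent_bounded_linear:
  assumes "0 < z"
  shows "bounded_linear (shifted_inverse D A (complex_of_real z))"
proof -
  have "bounded_linear (\<lambda>y. implicit_Euler D A (1 / z) (inverse z *\<^sub>R y))"
    using assms
    by (intro bounded_linear_compose[OF contraction_bounded_linear[OF Euler_contraction]]
        bounded_linear_scaleR_right) auto
  moreover have "implicit_Euler D A (1 / z) (inverse z *\<^sub>R y) = shifted_inverse D A (complex_of_real z) y" for y
    using assms by (simp add: implicit_Euler_def)
  ultimately show ?thesis
    by simp
qed

text \<open>The opposite sector lies in the left half-plane.\<close>

lemma infdist_opposite_sector_ge:
  assumes "0 \<le> \<alpha>" "\<alpha> < pi / 2"
  shows "z \<le> infdist (complex_of_real z) (uminus ` sector \<alpha>)"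
proof -
  have "1 \<in> sector \<alpha>"
    by (simp add: sector_def)
  then have ne: "uminus ` sector \<alpha> \<noteq> {}"
    by auto
  have "z \<le> dist (complex_of_real z) (- w)" if w: "w \<in> sector \<alpha>" for w
  proof -
    have "0 \<le> cos \<alpha> * cmod w"
      using cos_angle_pos[OF assms] by simp
    then have "0 \<le> Re w"
      using sector_Re_ge[OF w] assms by simp
    then have "z \<le> Re (complex_of_real z - (- w))"
      by simp
    also have "\<dots> \<le> dist (complex_of_real z) (- w)"
      unfolding dist_norm by (rule complex_Re_le_cmod)
    finally show ?thesis .
  qed
  then show ?thesis
    using ne by (auto simp: infdist_def intro!: cINF_greatest)
qed

section \<open>Rate of convergence in the operator norm\<close>

text \<open>Here \<open>1 - F = \<tau> S\<close>, so \<open>F\<close> is the explicit and \<open>B\<close> the implicit Euler step of \<open>S\<close>, and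
\<open>F - B = - (\<tau> S)\<^sup>2 B = - (1 - F) (1 - B)\<close>: again one smoothing factor on each side.\<close>

lemma quasi_sectorial_vs_Euler:
  fixes F S :: "'a::complex_hilbert_space \<Rightarrow> 'a"
  assumes \<alpha>: "0 \<le> \<alpha>" "\<alpha> < pi / 2"
    and F: "contraction F" and W: "numerical_range UNIV F \<subseteq> D_dom \<alpha>"
    and S: "sectorial_operator UNIV S c" and \<tau>: "0 < \<tau>" and S_eq: "\<And>x. S x = (x - F x) /\<^sub>R \<tau>"
    and n: "n \<ge> 1"
  shows "norm ((F ^^ n) x - (implicit_Euler UNIV S \<tau> ^^ n) x)
       \<le> 4 * (6 * (2 + 2 / (1 - sin \<alpha>) + 2 / cos \<alpha>) * sectorial_operator.decay_constant c)
         / sqrt (real n) * norm x"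
proof -
  interpret S: sectorial_operator UNIV S c by (rule S)
  define B where "B = implicit_Euler UNIV S \<tau>"
  note F_lin = contraction_linear_simps[OF F]
  define a where "a = 6 * (2 + 2 / (1 - sin \<alpha>) + 2 / cos \<alpha>)"
  have a: "0 \<le> a"
    using cos_angle_pos[OF \<alpha>] sin_angle_less_1[OF \<alpha>] by (simp add: a_def)
  have "norm ((F ^^ n) x - (B ^^ n) x)
      \<le> 4 * (a * 1 * sectorial_operator.decay_constant c) / sqrt (real n) * norm x"
  proof (rule funpow_difference_le[where X = "\<lambda>w. w - F w" and E = uminus and Y = "\<lambda>w. w - B w"])
    show "linear F"
      by (intro bounded_linear.linear contraction_bounded_linear F)
    show "F z - B z = - (z - B z) - F (- (z - B z))" for z
    proof -
      have "B z + \<tau> *\<^sub>R S (B z) = z"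
        unfolding B_def by (rule S.Euler_eq[OF \<tau>])
      then have "B z + (B z - F (B z)) = z"
        using \<tau> by (simp add: S_eq)
      then show ?thesis
        by (simp add: F_lin algebra_simps)
    qed
    show "norm ((F ^^ j) (w - F w)) \<le> a / (real j + 1) * norm w" for j w
      using quasi_sectorial_power_decay[OF \<alpha> F W, of j w]
      by (simp add: contraction_linear_simps[OF contraction_funpow[OF F]] funpow_swap1 a_def)
    show "norm ((B ^^ k) x - B ((B ^^ k) x)) \<le> sectorial_operator.decay_constant c / (real k + 1) * norm x" for k
      unfolding B_def by (rule S.Euler_power_decay[OF \<tau>])
  qed (use n a in auto)
  then show ?thesis
    by (simp add: B_def a_def)
qed

theorem theorem4p7:
  fixes F S T :: "real \<Rightarrow> 'a::complex_hilbert_space \<Rightarrow> 'a"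
    and D :: "'a set" and H :: "'a \<Rightarrow> 'a"
    and \<alpha> L :: real
  assumes alpha: "0 \<le> \<alpha>" "\<alpha> < pi / 2"
    and F_contraction: "\<And>\<tau>. \<tau> \<ge> 0 \<Longrightarrow> contraction (F \<tau>)"
    and F_quasi_sectorial: "\<And>\<tau>. \<tau> > 0 \<Longrightarrow> numerical_range UNIV (F \<tau>) \<subseteq> D_dom \<alpha>"
    and H_m_sectorial: "m_sectorial D H"
    and H_sector: "numerical_range D H \<subseteq> sector \<alpha>"
    and S_eq: "\<And>\<tau> x. \<tau> > 0 \<Longrightarrow> S \<tau> x = (x - F \<tau> x) /\<^sub>R \<tau>"
    and S_m_sectorial: "\<And>\<tau>. \<tau> > 0 \<Longrightarrow> m_sectorial UNIV (S \<tau>)"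
    and strong_limit: "\<And>x. ((\<lambda>\<tau>. shifted_inverse UNIV (S \<tau>) 1 x) \<longlongrightarrow>
                             shifted_inverse D H 1 x) (at_right 0)"
    and L_pos: "L > 0"
    and resolvent_estimate: "\<And>\<zeta> \<tau>. \<zeta> \<in> sector (pi - \<alpha>) \<Longrightarrow> \<tau> > 0 \<Longrightarrow>
           onorm (\<lambda>x. shifted_inverse UNIV (S \<tau>) \<zeta> x - shifted_inverse D H \<zeta> x)
             \<le> L * \<tau> / infdist \<zeta> (uminus ` sector \<alpha>)"
    and T_semigroup: "contraction_C0_semigroup T"
    and T_generator: "generator_of T D (\<lambda>x. - H x)"
  shows "\<forall>I::real set. is_interval I \<and> bounded I \<and> I \<subseteq> {0<..} \<longrightarrow>
           (\<exists>C>0. \<forall>n::nat. n \<ge> 1 \<longrightarrow>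
              (SUP t\<in>I. ereal (onorm (\<lambda>x. (F (t / real n) ^^ n) x - T t x)))
                \<le> ereal (C * (1 / real n powr (1/3))))"
proof (intro allI impI)
  fix I :: "real set"
  assume I: "is_interval I \<and> bounded I \<and> I \<subseteq> {0<..}"
  then obtain b where b: "0 < b" "\<And>t. t \<in> I \<Longrightarrow> t \<le> b"
    unfolding bounded_pos by (metis abs_le_D1 real_norm_def)
  define c where "c = cos \<alpha>"
  have c: "0 < c"
    unfolding c_def by (rule cos_angle_pos[OF alpha])
  have H_qm: "quasi_m_accretive D H"
    using H_m_sectorial by (simp add: m_sectorial_def)
  have H: "sectorial_operator D H c"
    using sectorial_operatorI[OF H_qm c] sector_Re_ge[of _ \<alpha>] alpha H_sector by (auto simp: c_def)
  have S: "sectorial_operator UNIV (S \<tau>) c" if \<tau>: "0 < \<tau>" for \<tau>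
  proof (rule sectorial_operatorI[OF _ c])
    show "quasi_m_accretive UNIV (S \<tau>)"
      using S_m_sectorial[OF \<tau>] by (simp add: m_sectorial_def)
    fix w assume "w \<in> numerical_range UNIV (S \<tau>)"
    then obtain x where x: "norm x = 1" "w = cinner x (S \<tau> x)"
      by (auto simp: numerical_range_def)
    define u where "u = 1 - cinner x (F \<tau> x)"
    have w: "w = complex_of_real (inverse \<tau>) * u"
      unfolding x(2) S_eq[OF \<tau>] cinner_scaleR_right
      by (simp add: u_def cinner_diff_right cinner_self x(1))
    have "cinner x (F \<tau> x) \<in> D_dom \<alpha>"
      using F_quasi_sectorial[OF \<tau>] x(1) by (auto simp: numerical_range_def)
    then have "c * cmod u \<le> Re u"
      unfolding u_def c_def by (rule D_dom_Re_ge[OF alpha])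
    then have "inverse \<tau> * (c * cmod u) \<le> inverse \<tau> * Re u"
      using \<tau> by (intro mult_left_mono) auto
    then show "c * cmod w \<le> Re w"
      using \<tau> by (simp add: w norm_mult norm_inverse mult_ac flip: of_real_inverse)
  qed
  interpret H: sectorial_operator D H c by (rule H)
  define d where "d = sectorial_operator.decay_constant c"
  have d: "0 < d"
    unfolding d_def by (rule H.decay_constant_pos)
  define a where "a = 6 * (2 + 2 / (1 - sin \<alpha>) + 2 / cos \<alpha>)"
  have a: "0 < a"
    using cos_angle_pos[OF alpha] sin_angle_less_1[OF alpha] by (simp add: a_def add_pos_pos)
  define C where "C = 4 * (a * d) + 4 * (1 + d)\<^sup>2 * (L * b) + 8 * d\<^sup>2"
  have C: "0 < C"
    using a d L_pos b by (simp add: C_def add_pos_pos)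
  show "\<exists>C>0. \<forall>n::nat. n \<ge> 1 \<longrightarrow>
      (SUP t\<in>I. ereal (onorm (\<lambda>x. (F (t / real n) ^^ n) x - T t x))) \<le> ereal (C * (1 / real n powr (1/3)))"
  proof (intro exI[of _ C] conjI allI impI C SUP_least)
    fix n :: nat and t :: real
    assume n: "1 \<le> n" and tI: "t \<in> I"
    have t: "0 < t" "t \<le> b"
      using I b tI by auto
    define \<tau> where "\<tau> = t / real n"
    have \<tau>: "0 < \<tau>" "real n * \<tau> = t"
      using t n by (auto simp: \<tau>_def)
    interpret S: sectorial_operator UNIV "S \<tau>" c by (rule S[OF \<tau>(1)])
    define B where "B = implicit_Euler UNIV (S \<tau>) \<tau>"
    define G where "G = implicit_Euler D H \<tau>"
    (* The distance of the point 1 / t from the opposite sector is at least 1 / t. *)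
    have resolvents: "norm (shifted_inverse UNIV (S \<tau>) (complex_of_real (1 / t)) y
        - shifted_inverse D H (complex_of_real (1 / t)) y) \<le> L * \<tau> * t * norm y" for y
    proof -
      let ?\<zeta> = "complex_of_real (1 / t)"
      let ?E = "\<lambda>y. shifted_inverse UNIV (S \<tau>) ?\<zeta> y - shifted_inverse D H ?\<zeta> y"
      have "bounded_linear ?E"
        using t by (intro bounded_linear_sub S.resolvent_bounded_linear H.resolvent_bounded_linear) auto
      then have "norm (?E y) \<le> onorm ?E * norm y"
        by (rule onorm)
      also have "onorm ?E \<le> L * \<tau> / infdist ?\<zeta> (uminus ` sector \<alpha>)"
        using t by (intro resolvent_estimate \<tau>) (simp add: sector_def)
      also have "\<dots> \<le> L * \<tau> / (1 / t)"
      proof (rule divide_left_mono)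
        show le: "1 / t \<le> infdist ?\<zeta> (uminus ` sector \<alpha>)"
          by (rule infdist_opposite_sector_ge[OF alpha])
        have "0 < 1 / t"
          using t(1) by simp
        then show "0 < infdist ?\<zeta> (uminus ` sector \<alpha>) * (1 / t)"
          by (intro mult_pos_pos less_le_trans[OF _ le])
        show "0 \<le> L * \<tau>"
          using L_pos \<tau>(1) by simp
      qed
      also have "L * \<tau> / (1 / t) = L * \<tau> * t"
        by simp
      finally show ?thesis
        by (simp add: mult_right_mono)
    qed
    have "norm ((F \<tau> ^^ n) x - T t x) \<le> C / sqrt (real n) * norm x" for x
    proof -
      have "norm ((F \<tau> ^^ n) x - (B ^^ n) x) \<le> 4 * (a * d) / sqrt (real n) * norm x"
        unfolding B_def a_def d_def
        using F_contraction[of \<tau>] \<tau>(1)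
        by (intro quasi_sectorial_vs_Euler[OF alpha _ F_quasi_sectorial S.sectorial_operator_axioms _ S_eq n]) auto
      moreover have "norm ((B ^^ n) x - (G ^^ n) x) \<le> 4 * (1 + d)\<^sup>2 * (L * \<tau> * t / \<tau>) / sqrt (real n) * norm x"
        unfolding B_def G_def d_def
        using resolvents L_pos \<tau> t
        by (intro Euler_powers_difference[OF S.sectorial_operator_axioms H \<tau>(1) n]) (auto simp: \<tau>(2))
      moreover have "4 * (1 + d)\<^sup>2 * (L * \<tau> * t / \<tau>) / sqrt (real n) * norm x
          \<le> 4 * (1 + d)\<^sup>2 * (L * b) / sqrt (real n) * norm x"
        using \<tau> t L_pos by (intro mult_right_mono divide_right_mono mult_left_mono) auto
      moreover have "norm ((G ^^ n) x - T t x) \<le> 8 * d\<^sup>2 / sqrt (real n) * norm x"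
        unfolding G_def \<tau>_def d_def
        by (rule H.Euler_semigroup_error[OF T_semigroup T_generator quasi_m_accretive_dense[OF H_qm] t(1) n])
      moreover have "norm ((F \<tau> ^^ n) x - T t x) \<le> norm ((F \<tau> ^^ n) x - (B ^^ n) x)
          + norm ((B ^^ n) x - (G ^^ n) x) + norm ((G ^^ n) x - T t x)"
        using norm_triangle_ineq[of "(F \<tau> ^^ n) x - (B ^^ n) x" "(B ^^ n) x - (G ^^ n) x"]
          norm_triangle_ineq[of "(F \<tau> ^^ n) x - (G ^^ n) x" "(G ^^ n) x - T t x"] by simp
      ultimately show ?thesis
        unfolding C_def add_divide_distrib distrib_right by linarith
    qed
    then have "onorm (\<lambda>x. (F \<tau> ^^ n) x - T t x) \<le> C / sqrt (real n)"
      using C by (intro onorm_bound) auto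
    also have "\<dots> = C * (1 / real n powr (1/2))"
      by (simp add: powr_half_sqrt)
    also have "\<dots> \<le> C * (1 / real n powr (1/3))"
      using C n by (intro mult_left_mono divide_left_mono powr_mono) auto
    finally show "ereal (onorm (\<lambda>x. (F (t / real n) ^^ n) x - T t x)) \<le> ereal (C * (1 / real n powr (1/3)))"
      by (simp add: \<tau>_def)
  qed
qed

end
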